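(* There exists a non-zero exhaustive submeasure $\nu$ on the algebra $\mathcal{B}$ of clopen subsets of the Cantor set $\{0,1\}^{\mathbb{N}}$ that is not uniformly exhaustive (and thus is not absolutely continuous with respect to a measure). Moreover, no non-zero measure $\mu$ on $\mathcal{B}$ is absolutely continuous with respect to $\nu$.
   Context: Let $\mathcal{B}$ be a Boolean algebra of sets and $\mathbb{R}^+=[0,\infty)$. A map $\nu:\mathcal{B}\to\mathbb{R}^+$ is a submeasure if $\nu(\varnothing)=0$; $A\subset B$ implies $\nu(A)\le\nu(B)$; and $\nu(A\cup B)\le\nu(A)+\nu(B)$ for all $A,B\in\mathcal{B}$. It is a measure (finitely additive) if moreover $\nu(A\cup B)=\nu(A)+\nu(B)$ whenever $A\cap B=\varnothing$. A sequence $(E_n)$ in $\mathcal{B}$ is disjoint if $E_n\cap E_m=\varnothing$ for $n\ne m$. A submeasure $\nu$ is exhaustive if $\lim_{n\to\infty}\nu(E_n)=0$ for every disjoint sequence $(E_n)$ of $\mathcal{B}$. It is uniformly exhaustive if for every $\varepsilon>0$ there is $n\geq 1$ such that for all pairwise disjoint $E_1,\dots,E_n\in\mathcal{B}$ one has $\inf_{i\le n}\nu(E_i)\le\varepsilon$. A submeasure $\nu_1$ is absolutely continuous with respect to a submeasure $\nu_2$ if for every $\varepsilon>0$ there is $\alpha>0$ such that, for all $A\in\mathcal{B}$, $\nu_2(A)\le\alpha$ implies $\nu_1(A)\le\varepsilon$. *)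

theory Defs
  imports "HOL-Analysis.Analysis"
begin

text \<open>
  Set functions are total real-valued functions on sets; only their values on the
  algebra \<open>B\<close> are meaningful, and every notion below is relativised to \<open>B\<close>.
\<close>

definition submeasure :: "'a set set \<Rightarrow> ('a set \<Rightarrow> real) \<Rightarrow> bool" where
  "submeasure B \<nu> \<longleftrightarrow>
     (\<forall>A\<in>B. 0 \<le> \<nu> A) \<and>
     \<nu> {} = 0 \<and>
     increasing B \<nu> \<and>
     (\<forall>A\<in>B. \<forall>A'\<in>B. \<nu> (A \<union> A') \<le> \<nu> A + \<nu> A')"

text \<open>Finite additivity only, and finite values: not the library's type of measures.\<close>

definition fin_add_measure :: "'a set set \<Rightarrow> ('a set \<Rightarrow> real) \<Rightarrow> bool" where
  "fin_add_measure B \<mu> \<longleftrightarrow> submeasure B \<mu> \<and> additive B \<mu>"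

definition nonzero_on :: "'a set set \<Rightarrow> ('a set \<Rightarrow> real) \<Rightarrow> bool" where
  "nonzero_on B \<nu> \<longleftrightarrow> (\<exists>A\<in>B. \<nu> A \<noteq> 0)"

definition exhaustive_on :: "'a set set \<Rightarrow> ('a set \<Rightarrow> real) \<Rightarrow> bool" where
  "exhaustive_on B \<nu> \<longleftrightarrow>
     (\<forall>E :: nat \<Rightarrow> 'a set. range E \<subseteq> B \<longrightarrow> disjoint_family E \<longrightarrow> (\<lambda>n. \<nu> (E n)) \<longlonglongrightarrow> 0)"

definition uniformly_exhaustive_on :: "'a set set \<Rightarrow> ('a set \<Rightarrow> real) \<Rightarrow> bool" where
  "uniformly_exhaustive_on B \<nu> \<longleftrightarrow>
     (\<forall>\<epsilon>>0. \<exists>n\<ge>1. \<forall>E :: nat \<Rightarrow> 'a set.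
        E ` {1..n} \<subseteq> B \<longrightarrow> disjoint_family_on E {1..n} \<longrightarrow> (INF i\<in>{1..n}. \<nu> (E i)) \<le> \<epsilon>)"

definition abs_cont_on :: "'a set set \<Rightarrow> ('a set \<Rightarrow> real) \<Rightarrow> ('a set \<Rightarrow> real) \<Rightarrow> bool" where
  "abs_cont_on B \<nu>\<^sub>1 \<nu>\<^sub>2 \<longleftrightarrow>
     (\<forall>\<epsilon>>0. \<exists>\<alpha>>0. \<forall>A\<in>B. \<nu>\<^sub>2 A \<le> \<alpha> \<longrightarrow> \<nu>\<^sub>1 A \<le> \<epsilon>)"

text \<open>
  The Cantor set is the type \<open>nat \<Rightarrow> bool\<close>, whose topology is the product topology
  of the discrete topology on \<open>bool\<close>.
\<close>

definition cantor_clopen :: "(nat \<Rightarrow> bool) set set" where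
  "cantor_clopen = {A. open A \<and> closed A}"

lemma algebra_cantor_clopen: "algebra UNIV cantor_clopen"
  unfolding algebra_iff_Un cantor_clopen_def
  by (auto simp: Compl_eq_Diff_UNIV[symmetric] open_Compl closed_Compl)

end

(*
  The construction is a streamlined form of Talagrand's. Level n of the Cantor set consists of the
  bits n^2, ..., n^2 + 2n. A set X is thin between levels m < n if, above every cylinder fixed up
  to level m, the points that avoid X and are determined up to level n still form a set that the
  covering sets of higher rank cannot cover with total weight below 1. A covering set of rank k is
  thin between any two elements of an index set I; it costs 2^-k (N/|I|)^alpha, where N is huge
  and alpha is tiny, so that replacing I by a fixed fraction of itself hardly changes the cost.

  Whole space: given a cheap cover, spread out the finitely many sets of the lowest rank k so that
  each owns a gap between two levels, chosen where the sets of higher rank live very little. Each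
  higher-rank set has a good fraction of its index set in one of the intervals between or inside
  the gaps, and it is avoided there. By downward induction on k, the whole space never becomes
  cheap, nor does a cylinder that fixes a single level; the latter gives failure of uniform
  exhaustivity.

  Since the definition of rank k refers to all higher ranks, one truncates at rank p and passes to
  the limit of the classes along an ultrafilter. For a disjoint sequence, either a finite union of
  its members leaves a large hole for the later ones, or the cheap covers of these unions converge
  to a countable family of finite total weight, whose tail covers what a clopen set misses. Either
  way the members of the sequence are, up to sets of small cost, thin along any prescribed number
  of levels, hence of cost about 2^-k.
*)
theory Submission
  imports Defs
begin

section \<open>Splicing points at a level; slices and saturations of sets\<close>

section \<open>Cylinders\<close>

text \<open>Points agree up to level \<open>n\<close> if they agree on the first \<open>n\<^sup>2\<close> bits, so that level \<open>n\<close>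
  carries \<open>2n + 1\<close> bits: enough room for \<open>n\<close> disjoint cylinders that fix this level only.\<close>

definition graft :: "nat \<Rightarrow> (nat \<Rightarrow> bool) \<Rightarrow> (nat \<Rightarrow> bool) \<Rightarrow> nat \<Rightarrow> bool" where
  "graft n x y = (\<lambda>i. if i < n * n then x i else y i)"

text \<open>The slice of \<open>X\<close> over the cylinder of \<open>x\<close>, read as a subset of
  the whole space: it ignores the levels below \<open>a\<close>, so no relative version of the
  classes is needed for cylinders.\<close>

definition sec :: "nat \<Rightarrow> (nat \<Rightarrow> bool) \<Rightarrow> (nat \<Rightarrow> bool) set \<Rightarrow> (nat \<Rightarrow> bool) set" where
  "sec a x X = {z. graft a x z \<in> X}"

text \<open>The saturation of \<open>X\<close>: the smallest set containing \<open>X\<close> that is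
  determined by the levels below \<open>b\<close>. Its complement is the largest such set disjoint
  from \<open>X\<close>.\<close>

definition hull_at :: "nat \<Rightarrow> (nat \<Rightarrow> bool) set \<Rightarrow> (nat \<Rightarrow> bool) set" where
  "hull_at b X = {z. \<exists>y. graft b z y \<in> X}"

lemma graft_graft_left: "a \<le> b \<Longrightarrow> graft a (graft b x y) z = graft a x z"
  using mult_le_mono[of a b a b] by (auto simp: graft_def fun_eq_iff)

lemma graft_graft_right: "a \<le> b \<Longrightarrow> graft b x (graft a y z) = graft b x z"
  using mult_le_mono[of a b a b] by (auto simp: graft_def fun_eq_iff)

lemma graft_assoc: "a \<le> b \<Longrightarrow> graft b (graft a x y) z = graft a x (graft b y z)"
  using mult_le_mono[of a b a b] by (auto simp: graft_def fun_eq_iff)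

lemma graft_same [simp]: "graft a x x = x"
  by (auto simp: graft_def)

lemma graft_0 [simp]: "graft 0 x y = y"
  by (auto simp: graft_def)

lemma sec_mono: "X \<subseteq> Y \<Longrightarrow> sec a x X \<subseteq> sec a x Y"
  by (auto simp: sec_def)

lemma hull_at_mono: "X \<subseteq> Y \<Longrightarrow> hull_at b X \<subseteq> hull_at b Y"
  by (auto simp: hull_at_def)

lemma subset_hull_at: "X \<subseteq> hull_at b X"
  unfolding hull_at_def by clarify (metis graft_same)

lemma hull_at_hull_at: "n \<le> b \<Longrightarrow> hull_at n (hull_at b X) = hull_at n X"
  unfolding hull_at_def by (auto simp: graft_assoc) (metis graft_same)

lemma hull_at_antimono: "n \<le> b \<Longrightarrow> hull_at b X \<subseteq> hull_at n X"
  by (metis hull_at_hull_at subset_hull_at)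

lemma hull_at_sec: "a \<le> n \<Longrightarrow> hull_at n (sec a x X) = sec a x (hull_at n X)"
  unfolding hull_at_def sec_def by (auto simp: graft_assoc)

lemma sec_sec: "a \<le> m \<Longrightarrow> sec m x (sec a y X) = sec m (graft a y x) X"
  unfolding sec_def by (auto simp: graft_assoc)

definition lev_dep :: "nat \<Rightarrow> (nat \<Rightarrow> bool) set \<Rightarrow> bool" where
  "lev_dep n A \<longleftrightarrow> (\<forall>x y. graft n x y \<in> A \<longleftrightarrow> x \<in> A)"

lemma lev_dep_hull_at: "lev_dep n (hull_at n X)"
  unfolding lev_dep_def hull_at_def by (simp add: graft_graft_left)

lemma lev_dep_hull_at_eq: "lev_dep n A \<Longrightarrow> hull_at n A = A"
  unfolding lev_dep_def hull_at_def by auto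

lemma lev_dep_mono: "lev_dep n A \<Longrightarrow> n \<le> b \<Longrightarrow> lev_dep b A"
  unfolding lev_dep_def by (metis graft_graft_left)

lemma lev_dep_sec: "lev_dep n A \<Longrightarrow> a \<le> n \<Longrightarrow> lev_dep n (sec a x A)"
  unfolding lev_dep_def sec_def by (simp add: graft_assoc[symmetric])

lemma lev_dep_Compl: "lev_dep n A \<Longrightarrow> lev_dep n (- A)"
  unfolding lev_dep_def by auto

lemma lev_dep_UN: "(\<And>i. i \<in> I \<Longrightarrow> lev_dep n (A i)) \<Longrightarrow> lev_dep n (\<Union>i\<in>I. A i)"
  unfolding lev_dep_def by auto

section \<open>The cost of an index set and its growth when the index set shrinks\<close>

section \<open>Weights\<close>

text \<open>The exponents satisfy \<open>(k + 7) * decay (k + 1) = (1/2) ^ (k + 1)\<close>: shrinking an index set by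
  the factor \<open>2 ^ (k + 7)\<close> at every step \<open>k\<close> costs at most a factor \<open>2\<close> altogether.
  The cardinality \<open>full_card k\<close> makes every index set of weight below 32 have at least
  \<open>2 ^ (2 * k + 19)\<close> elements.\<close>

definition decay :: "nat \<Rightarrow> real" where
  "decay k = 1 / (real (k + 6) * 2 ^ k)"

definition full_card :: "nat \<Rightarrow> nat" where
  "full_card k = 2 ^ (2 * k + 19 + (k + 5) * (k + 6) * 2 ^ k)"

definition wt :: "nat \<Rightarrow> nat \<Rightarrow> real" where
  "wt k c = (1/2) ^ k * (real (full_card k) / real c) powr decay k"

lemma decay_pos: "decay k > 0" unfolding decay_def by simp

lemma decay_le_1: "decay k \<le> 1"
proof -
  have "1 * 1 \<le> real (k + 6) * 2 ^ k" by (intro mult_mono) auto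
  then show ?thesis unfolding decay_def by simp
qed

lemma decay_antimono: "j \<le> k \<Longrightarrow> decay k \<le> decay j"
  unfolding decay_def by (intro divide_left_mono mult_mono power_increasing mult_pos_pos) auto

lemma full_card_pos: "full_card k > 0" unfolding full_card_def by simp

lemma wt_nonneg: "wt k c \<ge> 0" unfolding wt_def by simp

lemma wt_full: "wt k (full_card k) = (1/2) ^ k"
  unfolding wt_def using full_card_pos[of k] by simp

lemma wt_ge: "0 < c \<Longrightarrow> c \<le> full_card k \<Longrightarrow> wt k c \<ge> (1/2) ^ k"
  unfolding wt_def using ge_one_powr_ge_zero[of "real (full_card k) / real c" "decay k"] decay_pos[of k]
  by (simp add: mult_le_cancel_left1)

text \<open>The quotient in \<open>wt\<close> grows by at most the factor \<open>r\<close>, which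
  the exponent \<open>decay k\<close> damps.\<close>

lemma wt_shrink:
  assumes "0 < c" "0 < r" "real c \<le> r * real c'"
  shows "wt k c' \<le> r powr decay k * wt k c"
proof -
  have c': "0 < real c'" using assms by (metis gr0I mult_zero_right not_less of_nat_0 of_nat_0_less_iff)
  have "real (full_card k) / real c' \<le> r * (real (full_card k) / real c)"
    using assms c' full_card_pos[of k] by (simp add: field_simps)
  then have "(real (full_card k) / real c') powr decay k \<le> (r * (real (full_card k) / real c)) powr decay k"
    using decay_pos[of k] by (intro powr_mono2) auto
  also have "\<dots> = r powr decay k * (real (full_card k) / real c) powr decay k"
    using assms by (simp add: powr_mult flip: times_divide_eq_right)
  finally show ?thesis unfolding wt_def by (simp add: mult.left_commute)
qed

text \<open>Crude form, from \<open>decay k \<le> 1\<close>, for the steps in which a constant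
  factor is affordable.\<close>

lemma wt_shrink':
  assumes "0 < c" "1 \<le> r" "real c \<le> r * real c'"
  shows "wt k c' \<le> r * wt k c"
proof -
  have "wt k c' \<le> r powr decay k * wt k c" using wt_shrink assms by simp
  also have "\<dots> \<le> r * wt k c"
    using powr_mono[OF decay_le_1[of k] assms(2)] assms(2) wt_nonneg[of k c]
    by (intro mult_right_mono) auto
  finally show ?thesis .
qed

text \<open>A smaller \<open>c\<close> makes the quotient in \<open>wt\<close> at least
  \<open>2 ^ ((k + 5) * (k + 6) * 2 ^ k)\<close>. Raised to \<open>decay k\<close> this is
  \<open>2 ^ (k + 5)\<close>, and the factor \<open>(1/2) ^ k\<close> leaves 32.\<close>

lemma wt_less_imp_card:
  assumes "0 < c" "wt k c < 32"
  shows "2 ^ (2 * k + 19) \<le> c"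
proof (rule ccontr)
  assume "\<not> ?thesis"
  then have c: "real c \<le> 2 ^ (2 * k + 19)" by (metis linear of_nat_le_iff of_nat_numeral of_nat_power)
  have "2 ^ ((k + 5) * (k + 6) * 2 ^ k) \<le> real (full_card k) / real c"
    using c assms(1) by (simp add: full_card_def power_add field_simps)
  then have "(2 ^ ((k + 5) * (k + 6) * 2 ^ k)) powr decay k \<le> (real (full_card k) / real c) powr decay k"
    using decay_pos[of k] by (intro powr_mono2) auto
  moreover have "(2 ^ ((k + 5) * (k + 6) * 2 ^ k)) powr decay k = (2::real) ^ (k + 5)"
  proof -
    have "(2 ^ ((k + 5) * (k + 6) * 2 ^ k)) powr decay k
        = (2 powr real ((k + 5) * (k + 6) * 2 ^ k)) powr decay k"
      by (subst powr_realpow) auto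
    also have "\<dots> = 2 powr (real ((k + 5) * (k + 6) * 2 ^ k) * decay k)" by (simp add: powr_powr)
    also have "real ((k + 5) * (k + 6) * 2 ^ k) * decay k = real (k + 5)"
      unfolding decay_def by (simp only: of_nat_mult of_nat_power of_nat_numeral) simp
    finally show ?thesis using powr_realpow[of "2::real" "k + 5"] by simp
  qed
  ultimately have "(1/2) ^ k * 2 ^ (k + 5) \<le> wt k c"
    unfolding wt_def by (intro mult_left_mono) auto
  moreover have "(1/2) ^ k * 2 ^ (k + 5) = (32::real)"
    by (simp add: power_add power_divide)
  ultimately show False using assms(2) by simp
qed

section \<open>Thinness and the classes of covering sets, truncated at rank \<open>p\<close>\<close>

section \<open>Thin sets and the truncated classes\<close>

type_synonym triple = "nat \<times> (nat \<Rightarrow> bool) set \<times> nat set"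

abbreviation lvl :: "triple \<Rightarrow> nat" where "lvl t \<equiv> fst t"
abbreviation tset :: "triple \<Rightarrow> (nat \<Rightarrow> bool) set" where "tset t \<equiv> fst (snd t)"
abbreviation tidx :: "triple \<Rightarrow> nat set" where "tidx t \<equiv> snd (snd t)"

definition tw :: "triple \<Rightarrow> real" where
  "tw t = wt (lvl t) (card (tidx t))"

lemma tw_nonneg: "tw t \<ge> 0" unfolding tw_def by (rule wt_nonneg)

definition large :: "triple set \<Rightarrow> real \<Rightarrow> (nat \<Rightarrow> bool) set \<Rightarrow> bool" where
  "large C c A \<longleftrightarrow> (\<forall>F. finite F \<longrightarrow> F \<subseteq> C \<longrightarrow> sum tw F < c \<longrightarrow> \<not> A \<subseteq> (\<Union>t\<in>F. tset t))"

lemma large_mono: "large C c A \<Longrightarrow> A \<subseteq> A' \<Longrightarrow> c' \<le> c \<Longrightarrow> large C c' A'"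
  unfolding large_def by (meson order.strict_trans2 order.trans)

text \<open>The way largeness is used: the sets to be avoided are replaced by their traces
  \<open>h t\<close> on a stretch of levels, at the price of a factor \<open>f\<close>, and some
  point misses all traces. If \<open>h\<close> identifies triples, the weight only drops.\<close>

lemma large_avoid:
  assumes "large C c A" "finite F" "\<And>t. t \<in> F \<Longrightarrow> h t \<in> C" "\<And>t. t \<in> F \<Longrightarrow> tw (h t) \<le> f * tw t"
    and "f * sum tw F < c"
  obtains z where "z \<in> A" "\<And>t. t \<in> F \<Longrightarrow> z \<notin> tset (h t)"
proof -
  have "sum tw (h ` F) \<le> sum (tw \<circ> h) F"
    using assms(2) tw_nonneg by (intro sum_image_le) auto
  also have "\<dots> \<le> (\<Sum>t\<in>F. f * tw t)"
    using assms(4) by (intro sum_mono) auto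
  also have "\<dots> < c" using assms(5) by (simp add: sum_distrib_left)
  finally have "\<not> A \<subseteq> (\<Union>t\<in>h ` F. tset t)"
    using assms(1-3) unfolding large_def by blast
  then show ?thesis using that by auto
qed

text \<open>The complement of \<open>sec m x (hull_at n X)\<close> is the largest hole that \<open>X\<close> leaves between the
  levels \<open>m\<close> and \<open>n\<close> above the cylinder of \<open>x\<close>, transported to the whole space.\<close>

definition thin :: "triple set \<Rightarrow> nat \<Rightarrow> nat \<Rightarrow> (nat \<Rightarrow> bool) set \<Rightarrow> bool" where
  "thin C m n X \<longleftrightarrow> (\<forall>x. large C 1 (- sec m x (hull_at n X)))"

lemma thin_mono: "thin C m n X \<Longrightarrow> Y \<subseteq> X \<Longrightarrow> n \<le> b \<Longrightarrow> thin C m b Y"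
  unfolding thin_def
  by (meson Compl_anti_mono hull_at_antimono hull_at_mono large_mono order.trans order_refl sec_mono)

lemma thin_hull_at: "thin C m n X \<Longrightarrow> n \<le> b \<Longrightarrow> thin C m n (hull_at b X)"
  unfolding thin_def by (simp add: hull_at_hull_at)

lemma thin_sec: "thin C m n X \<Longrightarrow> a \<le> m \<Longrightarrow> m \<le> n \<Longrightarrow> thin C m n (sec a x X)"
  unfolding thin_def by (simp add: hull_at_sec sec_sec)

text \<open>Index sets must be nonempty: \<open>wt k 0 = 0\<close> because of division by zero.\<close>

definition thin_triples :: "nat \<Rightarrow> triple set \<Rightarrow> triple set" where
  "thin_triples k C = {t. lvl t = k \<and> finite (tidx t) \<and> tidx t \<noteq> {} \<and> card (tidx t) \<le> full_card k \<and>
     (\<forall>m\<in>tidx t. \<forall>n\<in>tidx t. m < n \<longrightarrow> thin C m n (tset t))}"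

function cls :: "nat \<Rightarrow> nat \<Rightarrow> triple set" where
  "cls p k = (if p \<le> k then {} else cls p (Suc k) \<union> thin_triples k (cls p (Suc k)))"
  by pat_completeness auto
termination by (relation "Wellfounded.measure (\<lambda>(p, k). p - k)") auto

declare cls.simps [simp del]

lemma cls_iff:
  "t \<in> cls p k \<longleftrightarrow> k \<le> lvl t \<and> lvl t < p \<and> t \<in> thin_triples (lvl t) (cls p (Suc (lvl t)))"
proof (induction p k rule: cls.induct)
  case (1 p k)
  show ?case
  proof (cases "p \<le> k")
    case True
    then show ?thesis by (subst cls.simps) auto
  next
    case False
    have l: "t \<in> thin_triples k C \<Longrightarrow> lvl t = k" for C by (auto simp: thin_triples_def)
    show ?thesis
      by (subst cls.simps) (use False 1[OF False] l in \<open>auto simp: Suc_le_eq le_less\<close>)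
  qed
qed

lemma cls_antimono: "k \<le> l \<Longrightarrow> cls p l \<subseteq> cls p k"
  by (auto simp: cls_iff[of _ p l] cls_iff[of _ p k])

lemma cls_memD:
  assumes "t \<in> cls p k"
  shows "finite (tidx t)" "tidx t \<noteq> {}" "card (tidx t) > 0" "card (tidx t) \<le> full_card (lvl t)" "k \<le> lvl t"
    "tw t \<ge> (1/2) ^ lvl t"
  using assms by (auto simp: cls_iff[of _ p k] thin_triples_def card_gt_0_iff tw_def intro!: wt_ge)

lemma cls_memI:
  assumes "k \<le> j" "j < p" "finite I" "I \<noteq> {}" "card I \<le> full_card j"
    and "\<And>m n. m \<in> I \<Longrightarrow> n \<in> I \<Longrightarrow> m < n \<Longrightarrow> thin (cls p (Suc j)) m n X"
  shows "(j, X, I) \<in> cls p k"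
  using assms by (auto simp: cls_iff[of _ p k] thin_triples_def)

lemma cls_thin:
  assumes "t \<in> cls p k" "m \<in> tidx t" "n \<in> tidx t" "m < n"
  shows "thin (cls p (Suc (lvl t))) m n (tset t)"
  using assms by (auto simp: cls_iff[of _ p k] thin_triples_def)

text \<open>For \<open>n < b\<close> the saturation at \<open>n\<close> cannot tell a set from its
  saturation at \<open>b\<close>, so thinness between indices below \<open>b\<close> survives the
  enlargement.\<close>

lemma cls_hull_at:
  assumes t: "t \<in> cls p k" and I: "I \<subseteq> tidx t" "I \<subseteq> {..<b}" "I \<noteq> {}"
  shows "(lvl t, hull_at b (tset t), I) \<in> cls p k"
proof (rule cls_memI)
  note D = cls_memD[OF t]
  show "finite I" using I D finite_subset by blast
  show "card I \<le> full_card (lvl t)" using I D card_mono order.trans by metis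
  show "k \<le> lvl t" "lvl t < p" using t by (auto simp: cls_iff[of _ p k])
  show "thin (cls p (Suc (lvl t))) m n (hull_at b (tset t))" if "m \<in> I" "n \<in> I" "m < n" for m n
    using that I cls_thin[OF t, of m n] by (intro thin_hull_at) auto
qed (use I in auto)

text \<open>Thinness from level \<open>m\<close> is demanded above every cylinder; for
  \<open>a \<le> m\<close> this includes the cylinders that follow \<open>x\<close> up to level
  \<open>a\<close>.\<close>

lemma cls_sec:
  assumes t: "t \<in> cls p k" and I: "I \<subseteq> tidx t" "I \<subseteq> {a..}" "I \<noteq> {}"
  shows "(lvl t, sec a x (tset t), I) \<in> cls p k"
proof (rule cls_memI)
  note D = cls_memD[OF t]
  show "finite I" using I D finite_subset by blast
  show "card I \<le> full_card (lvl t)" using I D card_mono order.trans by metis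
  show "k \<le> lvl t" "lvl t < p" using t by (auto simp: cls_iff[of _ p k])
  show "thin (cls p (Suc (lvl t))) m n (sec a x (tset t))" if "m \<in> I" "n \<in> I" "m < n" for m n
    using that I cls_thin[OF t, of m n] by (intro thin_sec) auto
qed (use I in auto)

section \<open>Lower bounds on the weight of covers of the space and of one-level cylinders\<close>

section \<open>The whole space is not cheap\<close>

lemma spread_of_gaps:
  fixes v :: "nat \<Rightarrow> real"
  assumes "finite J" "card J = Suc t" "\<And>m n. m \<in> J \<Longrightarrow> n \<in> J \<Longrightarrow> m < n \<Longrightarrow> \<delta> \<le> v n - v m"
  shows "real t * \<delta> \<le> v (Max J) - v (Min J)"
  using assms
proof (induction t arbitrary: J)
  case 0
  then obtain j where "J = {j}" by (auto simp: card_Suc_eq)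
  then show ?case by simp
next
  case (Suc t)
  define J' where "J' = J - {Max J}"
  have ne: "J \<noteq> {}" using Suc.prems by auto
  have c: "card J' = Suc t" using Suc.prems ne by (simp add: J'_def)
  then have ne': "J' \<noteq> {}" by auto
  have fin: "finite J'" using Suc.prems by (simp add: J'_def)
  have IH: "real t * \<delta> \<le> v (Max J') - v (Min J')"
    using Suc.prems by (intro Suc.IH[OF fin c]) (auto simp: J'_def)
  have mx: "Max J' \<in> J'" using Max_in[OF fin ne'] .
  then have "Max J' < Max J" using Suc.prems(1) by (auto simp: J'_def intro!: le_neq_trans)
  moreover have "Max J \<in> J" using Max_in Suc.prems(1) ne by blast
  ultimately have d: "\<delta> \<le> v (Max J) - v (Max J')"
    using Suc.prems(3)[of "Max J'" "Max J"] mx by (auto simp: J'_def)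
  have "Min J' = Min J"
  proof (rule antisym)
    have "Min J \<noteq> Max J"
    proof
      assume "Min J = Max J"
      then have "j = Max J" if "j \<in> J" for j
        using Min_le[OF Suc.prems(1) that] Max_ge[OF Suc.prems(1) that] by simp
      then have "J' = {}" by (auto simp: J'_def)
      then show False using ne' by simp
    qed
    then have "Min J \<in> J'" using Min_in[OF Suc.prems(1) ne] by (simp add: J'_def)
    then show "Min J' \<le> Min J" using fin by simp
    show "Min J \<le> Min J'" using Min_in[OF fin ne'] Suc.prems(1) by (auto simp: J'_def)
  qed
  then show ?case using IH d by (simp add: distrib_right)
qed

text \<open>Pigeonhole: if all gaps were at least \<open>\<delta>\<close>, then \<open>t\<close>
  consecutive ones would exceed the range of \<open>v\<close>, which lies between 0 and
  \<open>W\<close>.\<close>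

lemma small_gap:
  fixes v :: "nat \<Rightarrow> real"
  assumes "finite J" "Suc t \<le> card J" "\<And>n. 0 \<le> v n" "\<And>n. v n \<le> W" "W < real t * \<delta>"
  obtains m n where "m \<in> J" "n \<in> J" "m < n" "v n - v m < \<delta>"
proof -
  obtain K where K: "K \<subseteq> J" "card K = Suc t" using obtain_subset_with_card_n[OF assms(2)] by metis
  have "finite K" using K assms(1) finite_subset by blast
  have "\<exists>m\<in>K. \<exists>n\<in>K. m < n \<and> v n - v m < \<delta>"
  proof (rule ccontr)
    assume "\<not> ?thesis"
    then have "real t * \<delta> \<le> v (Max K) - v (Min K)"
      using \<open>finite K\<close> K by (intro spread_of_gaps) force+
    with assms(3)[of "Min K"] assms(4)[of "Max K"] assms(5) show False by simp
  qed
  then show ?thesis using that K by blast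
qed

lemma card_Int_split:
  fixes I :: "nat set"
  assumes "finite I" "a \<le> m"
  shows "card (I \<inter> {a..}) = card (I \<inter> {a..<m}) + card (I \<inter> {m..})"
  using assms by (subst card_Un_disjoint[symmetric]) (auto intro!: arg_cong[where f = card])

text \<open>The point is built level by level. Among the remaining thin sets, pick the one whose index set
  is the first to show \<open>Suc T\<close> elements beyond level \<open>a\<close>; the others lose at most \<open>T\<close>
  elements up to there. One of its \<open>T\<close> gaps carries so little of the weight of \<open>G'\<close> that the
  hole in this gap is not covered. The bound \<open>2 * card L + 1\<close> counts the intervals still to come,
  so that every set that is not handled now keeps a large enough share beyond the gap.\<close>

lemma avoid_thin_and_covers:
  fixes T :: nat
  assumes big: "large (cls p k) c UNIV" and G: "finite G" "G \<subseteq> cls p k" and r: "1 \<le> r" and f: "0 \<le> f"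
    and shrink: "\<And>t c'. t \<in> G \<Longrightarrow> real (card (tidx t)) \<le> r * real c' \<Longrightarrow> wt (lvl t) c' \<le> f * tw t"
    and wG: "f * sum tw G < c" "f * r * sum tw G < real T"
  shows "finite L \<Longrightarrow> G' \<subseteq> G \<Longrightarrow>
    (\<And>X J. (X, J) \<in> L \<Longrightarrow> finite J \<and> card L * Suc T \<le> card (J \<inter> {a..}) \<and>
        (\<forall>m\<in>J. \<forall>n\<in>J. m < n \<longrightarrow> thin (cls p k) m n X)) \<Longrightarrow>
    (\<And>t. t \<in> G' \<Longrightarrow> real (2 * card L + 1) * real (card (tidx t)) \<le> r * real (card (tidx t \<inter> {a..}))) \<Longrightarrow>
    \<exists>z. (\<forall>(X, J)\<in>L. graft a x z \<notin> X) \<and> (\<forall>t\<in>G'. graft a x z \<notin> tset t)"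
proof (induction "card L" arbitrary: L G' a x)
  case 0
  then have L: "L = {}" by simp
  have finG': "finite G'" using finite_subset[OF 0(3) G(1)] .
  have sG': "sum tw G' \<le> sum tw G" using 0(3) G(1) tw_nonneg by (intro sum_mono2) auto
  define h where "h t = (lvl t, sec a x (tset t), tidx t \<inter> {a..})" for t :: triple
  have card: "real (card (tidx t)) \<le> r * real (card (tidx t \<inter> {a..}))" if "t \<in> G'" for t
    using 0(5)[OF that] L by simp
  have mem: "h t \<in> cls p k" if "t \<in> G'" for t
  proof -
    have tC: "t \<in> cls p k" using that 0(3) G(2) by auto
    have "tidx t \<inter> {a..} \<noteq> {}"
      using card[OF that] cls_memD(3)[OF tC] by (intro notI) simp
    then show ?thesis unfolding h_def by (intro cls_sec[OF tC]) auto
  qed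
  have wh: "tw (h t) \<le> f * tw t" if "t \<in> G'" for t
  proof -
    have "wt (lvl t) (card (tidx t \<inter> {a..})) \<le> f * tw t"
      using that 0(3) card[OF that] by (intro shrink) blast+
    then show ?thesis by (simp add: h_def tw_def)
  qed
  have "f * sum tw G' \<le> f * sum tw G" using sG' f by (intro mult_left_mono)
  then have "f * sum tw G' < c" using wG by simp
  from large_avoid[OF big finG' mem wh this] obtain z where "\<And>t. t \<in> G' \<Longrightarrow> z \<notin> tset (h t)" by metis
  then have "\<forall>t\<in>G'. graft a x z \<notin> tset t" by (simp add: h_def sec_def)
  then show ?case using L by blast
next
  case (Suc s)
  have finG': "finite G'" using finite_subset[OF Suc.prems(2) G(1)] .
  have sub: "f * sum tw G1 \<le> f * sum tw G" if "G1 \<subseteq> G'" for G1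
    using that Suc.prems(2) G(1) tw_nonneg f by (intro mult_left_mono sum_mono2) auto
  have G'C: "t \<in> cls p k" if "t \<in> G'" for t using that Suc.prems(2) G(2) by auto
  define P where "P b \<longleftrightarrow> (\<exists>(X, J)\<in>L. Suc T \<le> card (J \<inter> {a..b}))" for b
  have "L \<noteq> {}" using Suc(2) by auto
  then obtain X1 J1 where XJ1: "(X1, J1) \<in> L" by auto
  have "J1 \<inter> {a..} = J1 \<inter> {a..Max (insert a J1)}" using Suc.prems(3)[OF XJ1] by auto
  moreover have "Suc T \<le> card (J1 \<inter> {a..})"
  proof -
    have "Suc s * Suc T \<le> card (J1 \<inter> {a..})" using Suc.prems(3)[OF XJ1] Suc(2) by metis
    then show ?thesis by simp
  qed
  ultimately have "P (Max (insert a J1))" using XJ1 by (auto simp: P_def)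
  define b where "b = (LEAST b. P b)"
  have "P b" unfolding b_def using \<open>P (Max _)\<close> by (rule LeastI)
  then obtain X0 J0 where XJ0: "(X0, J0) \<in> L" "Suc T \<le> card (J0 \<inter> {a..b})" by (auto simp: P_def)
  have few: "card (J \<inter> {a..<b}) \<le> T" if "(X, J) \<in> L" for X J
  proof (cases "b = 0")
    case False
    have "\<not> P (b - 1)" using False unfolding b_def by (intro not_less_Least) auto
    then have "card (J \<inter> {a..b - 1}) \<le> T" using that by (auto simp: P_def)
    moreover have "{a..<b} = {a..b - 1}" using False by auto
    ultimately show ?thesis by simp
  qed simp
  \<comment> \<open>The weight of each triple of \<open>G'\<close> is spread evenly over its index
    set; \<open>v n\<close> is the amount that lies below level \<open>n\<close>.\<close>
  define v where "v n = (\<Sum>t\<in>G'. tw t * real (card (tidx t \<inter> {..<n})) / real (card (tidx t)))" for n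
  have v0: "0 \<le> v n" for n unfolding v_def by (intro sum_nonneg divide_nonneg_nonneg mult_nonneg_nonneg tw_nonneg) auto
  have v1: "v n \<le> sum tw G'" for n
    unfolding v_def
  proof (intro sum_mono)
    fix t assume "t \<in> G'"
    note D = cls_memD[OF G'C[OF this]]
    have "card (tidx t \<inter> {..<n}) \<le> card (tidx t)" using D by (intro card_mono) auto
    then have "tw t * real (card (tidx t \<inter> {..<n})) \<le> tw t * real (card (tidx t))"
      using tw_nonneg by (intro mult_left_mono) auto
    then show "tw t * real (card (tidx t \<inter> {..<n})) / real (card (tidx t)) \<le> tw t"
      using D by (simp add: divide_le_eq)
  qed
  have frW: "f * r * sum tw G' < real T * 1"
  proof -
    have "r * (f * sum tw G') \<le> r * (f * sum tw G)" 
      using r by (intro mult_left_mono sub[OF order_refl]) auto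
    then show ?thesis using wG(2) by (simp add: mult_ac)
  qed
  have finJ0: "finite (J0 \<inter> {a..b})" by simp
  have u0: "0 \<le> f * r * v n" for n using v0[of n] f r by simp
  have u1: "f * r * v n \<le> f * r * sum tw G'" for n using v1[of n] f r by (intro mult_left_mono) auto
  \<comment> \<open>The factor \<open>f * r\<close> anticipates two losses: a triple of
    \<open>G2\<close> has at least a fraction \<open>1 / r\<close> of its indices in the gap, and
    restricting to them multiplies its weight by at most \<open>f\<close>.\<close>
  obtain m n where mn: "m \<in> J0 \<inter> {a..b}" "n \<in> J0 \<inter> {a..b}" "m < n" "f * r * v n - f * r * v m < 1"
    by (rule small_gap[OF finJ0 XJ0(2) u0 u1 frW])
  \<comment> \<open>Triples with a share \<open>1 / r\<close> of their indices before the gap or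
    inside it are avoided at once; the rest, \<open>G3\<close>, are left to the recursion beyond
    \<open>n\<close>.\<close>
  define G1 where "G1 = {t\<in>G'. real (card (tidx t)) \<le> r * real (card (tidx t \<inter> {a..<m}))}"
  define G2 where "G2 = {t\<in>G'. real (card (tidx t)) \<le> r * real (card (tidx t \<inter> {m..<n}))}"
  define G3 where "G3 = G' - (G1 \<union> G2)"
  define h where "h u v y t = (lvl t, sec u y (hull_at v (tset t)), tidx t \<inter> {u..<v})"
    for u v :: nat and y :: "nat \<Rightarrow> bool" and t :: triple
  have mem: "h u v y t \<in> cls p k"
    if "t \<in> G'" "real (card (tidx t)) \<le> r * real (card (tidx t \<inter> {u..<v}))" for t u v y
  proof -
    have ne: "tidx t \<inter> {u..<v} \<noteq> {}"
      using that(2) cls_memD(3)[OF G'C[OF that(1)]] by (intro notI) simp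
    have 1: "(lvl t, hull_at v (tset t), tidx t \<inter> {..<v}) \<in> cls p k"
      using ne by (intro cls_hull_at[OF G'C[OF that(1)]]) auto
    show ?thesis
      using cls_sec[OF 1, of "tidx t \<inter> {u..<v}" u y] ne unfolding h_def by (simp add: Int_assoc subset_iff)
  qed
  have wh: "tw (h u v y t) \<le> f * tw t"
    if "t \<in> G'" "real (card (tidx t)) \<le> r * real (card (tidx t \<inter> {u..<v}))" for t u v y
  proof -
    have "wt (lvl t) (card (tidx t \<inter> {u..<v})) \<le> f * tw t"
      using that Suc.prems(2) by (intro shrink) blast+
    then show ?thesis by (simp add: h_def tw_def)
  qed
  have fG1: "finite G1" "finite G2" using finG' by (auto simp: G1_def G2_def)
  have wG1: "f * sum tw G1 < c" using sub[of G1] wG by (auto simp: G1_def)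
  \<comment> \<open>No set of \<open>L\<close> has to be avoided between \<open>a\<close> and
    \<open>m\<close>, so largeness of the whole space suffices on this stretch.\<close>
  obtain z1 where z1: "\<And>t. t \<in> G1 \<Longrightarrow> z1 \<notin> tset (h a m x t)"
  proof (rule large_avoid[OF big fG1(1) _ _ wG1, of "h a m x"])
    show "h a m x t \<in> cls p k" "tw (h a m x t) \<le> f * tw t" if "t \<in> G1" for t
      using that mem wh unfolding G1_def by blast+
  qed blast
  define x1 where "x1 = graft a x z1"
  have x1: "graft m x1 y \<notin> tset t" if "t \<in> G1" for t y
    using z1[OF that] mn by (auto simp: h_def sec_def hull_at_def x1_def)
  have wG2: "f * sum tw G2 < 1"
  proof -
    have "tw t \<le> r * (tw t * real (card (tidx t \<inter> {m..<n})) / real (card (tidx t)))" if "t \<in> G2" for t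
    proof -
      have "0 < card (tidx t)" using that cls_memD(3)[OF G'C] by (auto simp: G2_def)
      moreover have "tw t * real (card (tidx t)) \<le> tw t * (r * real (card (tidx t \<inter> {m..<n})))"
        using that tw_nonneg by (intro mult_left_mono) (auto simp: G2_def)
      ultimately show ?thesis by (simp add: field_simps)
    qed
    then have "sum tw G2 \<le> (\<Sum>t\<in>G2. r * (tw t * real (card (tidx t \<inter> {m..<n})) / real (card (tidx t))))"
      by (intro sum_mono)
    also have "\<dots> \<le> (\<Sum>t\<in>G'. r * (tw t * real (card (tidx t \<inter> {m..<n})) / real (card (tidx t))))"
      using finG' r tw_nonneg
      by (intro sum_mono2) (auto simp: G2_def intro!: mult_nonneg_nonneg divide_nonneg_nonneg)
    also have "\<dots> = r * (v n - v m)"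
      unfolding v_def sum_subtractf[symmetric] sum_distrib_left
    proof (intro sum.cong refl)
      fix t assume "t \<in> G'"
      then have "finite (tidx t)" using cls_memD(1)[OF G'C] by auto
      then have "card (tidx t \<inter> {..<n}) = card (tidx t \<inter> {..<m}) + card (tidx t \<inter> {m..<n})"
        using mn(3) by (subst card_Un_disjoint[symmetric]) (auto intro!: arg_cong[where f = card])
      then show "r * (tw t * real (card (tidx t \<inter> {m..<n})) / real (card (tidx t)))
          = r * (tw t * real (card (tidx t \<inter> {..<n})) / real (card (tidx t))
            - tw t * real (card (tidx t \<inter> {..<m})) / real (card (tidx t)))"
        by (simp add: distrib_left add_divide_distrib)
    qed
    finally have "f * sum tw G2 \<le> f * (r * (v n - v m))" using f by (intro mult_left_mono)
    then show ?thesis using mn(4) by (simp add: algebra_simps)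
  qed
  have "thin (cls p k) m n X0" using Suc.prems(3)[OF XJ0(1)] mn by auto
  then have big0: "large (cls p k) 1 (- sec m x1 (hull_at n X0))" by (simp add: thin_def)
  \<comment> \<open>Inside the gap the point must lie in the hole of \<open>X0\<close> and also
    avoid \<open>G2\<close>; this is where the threshold 1 in \<open>thin\<close> is used.\<close>
  obtain z2 where z2: "z2 \<in> - sec m x1 (hull_at n X0)" "\<And>t. t \<in> G2 \<Longrightarrow> z2 \<notin> tset (h m n x1 t)"
  proof (rule large_avoid[OF big0 fG1(2) _ _ wG2, of "h m n x1"])
    show "h m n x1 t \<in> cls p k" "tw (h m n x1 t) \<le> f * tw t" if "t \<in> G2" for t
      using that mem wh unfolding G2_def by blast+
  qed blast
  define x2 where "x2 = graft m x1 z2"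
  have x2: "graft n x2 y \<notin> tset t" if "t \<in> G2" for t y
    using z2(2)[OF that] mn by (auto simp: h_def sec_def hull_at_def x2_def)
  have x20: "graft n x2 y \<notin> X0" for y
    using z2(1) mn by (auto simp: sec_def hull_at_def x2_def)
  have x21: "graft n x2 y = graft m x1 (graft n x2 y)" for y
    using mn(3) by (simp add: x2_def graft_assoc graft_graft_right)
  have x2a: "graft n x2 y = graft a x (graft n x2 y)" for y
  proof -
    have am: "a \<le> m" using mn(1) by simp
    have "graft m x1 w = graft a x (graft m z1 w)" for w by (simp add: x1_def graft_assoc[OF am])
    then show ?thesis by (metis x21 graft_graft_right order_refl)
  qed
  define L' where "L' = L - {(X0, J0)}"
  have cL': "card L' = s" using Suc(2) XJ0(1) Suc.prems(1) by (simp add: L'_def)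
  have "\<exists>z. (\<forall>(X, J)\<in>L'. graft n x2 z \<notin> X) \<and> (\<forall>t\<in>G3. graft n x2 z \<notin> tset t)"
  proof (rule Suc.hyps(1))
    show "s = card L'" using cL' by simp
    show "finite L'" using Suc.prems(1) by (simp add: L'_def)
    show "G3 \<subseteq> G" using Suc.prems(2) by (auto simp: G3_def)
    show "finite J \<and> card L' * Suc T \<le> card (J \<inter> {n..}) \<and> (\<forall>m\<in>J. \<forall>n\<in>J. m < n \<longrightarrow> thin (cls p k) m n X)"
      if "(X, J) \<in> L'" for X J
    proof -
      have XJ: "(X, J) \<in> L" using that by (simp add: L'_def)
      have fJ: "finite J" using Suc.prems(3)[OF XJ] by simp
      \<comment> \<open>By minimality of \<open>b\<close>, at most \<open>T\<close> of these indices
        lie before \<open>b\<close>, and \<open>n \<le> b\<close>; hence \<open>s * Suc T\<close> of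
        them remain from \<open>n\<close> on.\<close>
      have "Suc s * Suc T \<le> card (J \<inter> {a..})" using Suc.prems(3)[OF XJ] Suc(2) by metis
      moreover have "card (J \<inter> {a..}) = card (J \<inter> {a..<b}) + card (J \<inter> {b..})"
        using mn fJ by (intro card_Int_split) auto
      moreover have "card (J \<inter> {b..}) \<le> card (J \<inter> {n..})" using mn fJ by (intro card_mono) auto
      ultimately have "s * Suc T \<le> card (J \<inter> {n..})" using few[OF XJ] by simp
      then show ?thesis using Suc.prems(3)[OF XJ] cL' by simp
    qed
    show "real (2 * card L' + 1) * real (card (tidx t)) \<le> r * real (card (tidx t \<inter> {n..}))" if "t \<in> G3" for t
    proof -
      have t: "t \<in> G'" "\<not> real (card (tidx t)) \<le> r * real (card (tidx t \<inter> {a..<m}))"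
        "\<not> real (card (tidx t)) \<le> r * real (card (tidx t \<inter> {m..<n}))"
        using that by (auto simp: G3_def G1_def G2_def)
      have fi: "finite (tidx t)" using cls_memD(1)[OF G'C[OF t(1)]] .
      have "card (tidx t \<inter> {a..}) = card (tidx t \<inter> {a..<m}) + (card (tidx t \<inter> {m..<n}) + card (tidx t \<inter> {n..}))"
        using card_Int_split[OF fi, of a m] card_Int_split[OF fi, of m n] mn by auto
      then have "r * real (card (tidx t \<inter> {a..})) = r * real (card (tidx t \<inter> {a..<m})) +
          (r * real (card (tidx t \<inter> {m..<n})) + r * real (card (tidx t \<inter> {n..})))"
        by (simp add: distrib_left)
      \<comment> \<open>Two of the \<open>2 * Suc s + 1\<close> units pay for the stretch before the
        gap and for the gap, each of which holds less than a fraction \<open>1 / r\<close> of the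
        indices.\<close>
      moreover have "real (2 * Suc s + 1) * real (card (tidx t)) \<le> r * real (card (tidx t \<inter> {a..}))"
        using Suc.prems(4)[OF t(1)] Suc(2) by metis
      ultimately show ?thesis using t cL' by (simp add: algebra_simps)
    qed
  qed
  then obtain z where z: "\<And>X J. (X, J) \<in> L' \<Longrightarrow> graft n x2 z \<notin> X" "\<And>t. t \<in> G3 \<Longrightarrow> graft n x2 z \<notin> tset t"
    by auto
  have "graft a x (graft n x2 z) \<notin> X" if "(X, J) \<in> L" for X J
    using that z(1)[of X J] x20[of z] x2a[of z] by (cases "(X, J) \<in> L'") (auto simp: L'_def)
  moreover have "graft a x (graft n x2 z) \<notin> tset t" if "t \<in> G'" for t
    using that z(2)[of t] x2[of t z] x1[of t "graft n x2 z"] x2a[of z] x21[of z] by (auto simp: G3_def)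
  ultimately show ?case by blast
qed

lemma tw_le_sum: "finite F \<Longrightarrow> t \<in> F \<Longrightarrow> tw t \<le> sum tw F"
  using tw_nonneg by (intro member_le_sum) auto

lemma cls_card_ge: "t \<in> cls p k \<Longrightarrow> tw t < 32 \<Longrightarrow> 2 ^ (2 * lvl t + 19) \<le> card (tidx t)"
  using wt_less_imp_card[of "card (tidx t)" "lvl t"] cls_memD(3) by (auto simp: tw_def)

lemma cls_shrink:
  assumes "t \<in> cls p k" "1 \<le> r" "real (card (tidx t)) \<le> r * real c'"
  shows "wt (lvl t) c' \<le> r * tw t"
  using wt_shrink'[of "card (tidx t)" r c'] assms cls_memD(3)[OF assms(1)] by (simp add: tw_def)

text \<open>Downward induction on the rank. Passing from \<open>Suc k\<close> to \<open>k\<close>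
  divides the threshold by \<open>2 powr h\<close> with \<open>h = (1/2) ^ Suc k\<close>, which
  bounds the gain in weight when an index set is cut to a fraction \<open>1 / 2 ^ (k + 7)\<close>.
  These exponents sum to at most 1, so the threshold never falls below 16.\<close>

lemma large_cls_UNIV_powr: "large (cls p k) (2 powr (5 - (1/2) ^ k)) UNIV"
proof (induction p k rule: cls.induct)
  case (1 p k)
  show ?case
  proof (cases "p \<le> k")
    case True
    then have "cls p k = {}" by (simp add: cls.simps)
    then show ?thesis by (auto simp: large_def)
  next
    case False
    define h :: real where "h = (1/2) ^ Suc k"
    have h: "(1/2) ^ k = 2 * h" "0 < h" by (auto simp: h_def)
    have h1: "h \<le> 1" unfolding h_def by (intro power_le_one) auto
    have IH: "large (cls p (Suc k)) (2 powr (5 - h)) UNIV" using 1[OF False] by (simp add: h_def)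
    have "\<not> UNIV \<subseteq> (\<Union>t\<in>F. tset t)"
      if F: "finite F" "F \<subseteq> cls p k" "sum tw F < 2 powr (5 - (1/2) ^ k)" for F
    proof -
      define G where "G = F \<inter> cls p (Suc k)"
      define F2 where "F2 = F - cls p (Suc k)"
      define L where "L = snd ` F2"
      have F2: "t \<in> thin_triples k (cls p (Suc k))" "lvl t = k" if "t \<in> F2" for t
      proof -
        have t: "t \<in> cls p k" "t \<notin> cls p (Suc k)" using that F(2) by (auto simp: F2_def)
        then show "lvl t = k"
          unfolding cls_iff[of t p k] cls_iff[of t p "Suc k"] by (metis Suc_leI le_neq_implies_less)
        then show "t \<in> thin_triples k (cls p (Suc k))" using t cls_iff[of t p k] by metis
      qed
      have fin: "finite G" "finite F2" "finite L" using F by (auto simp: G_def F2_def L_def)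
      have "2 powr (5 - (1/2) ^ k) \<le> 2 powr (5::real)" by (intro powr_mono) auto
      then have W: "sum tw F < 32" using F(3) by simp
      have sG: "sum tw G \<le> sum tw F" using F tw_nonneg by (intro sum_mono2) (auto simp: G_def)
      \<comment> \<open>Every set of rank \<open>k\<close> weighs at least \<open>(1/2) ^ k\<close>,
        so a total below 32 leaves fewer than \<open>2 ^ (k + 5)\<close> of them.\<close>
      have "real (card F2) * (1/2) ^ k = (\<Sum>t\<in>F2. (1/2) ^ k)" by simp
      also have "\<dots> \<le> sum tw F2"
      proof (intro sum_mono)
        fix t assume "t \<in> F2"
        then show "(1/2) ^ k \<le> tw t" using cls_memD(6)[of t p k] F2(2)[of t] F(2) by (auto simp: F2_def)
      qed
      also have "\<dots> \<le> sum tw F" using F tw_nonneg by (intro sum_mono2) (auto simp: F2_def)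
      also have "\<dots> < 32" by fact
      finally have "real (card F2) < 2 ^ (k + 5)" by (simp add: power_add field_simps)
      then have cF2: "card F2 \<le> 2 ^ (k + 5)"
        by (metis less_imp_le of_nat_less_iff of_nat_numeral of_nat_power)
      then have cL: "card L \<le> 2 ^ (k + 5)" using card_image_le[OF fin(2), of snd] by (simp add: L_def)
      define f :: real where "f = 2 powr h"
      have f2: "f \<le> 2" unfolding f_def using powr_mono[of h 1 2] h1 by simp
      \<comment> \<open>Here \<open>r = 2 ^ (k + 7)\<close> is at least
        \<open>2 * card L + 1\<close>, and \<open>T = 2 ^ (k + 13)\<close> bounds
        \<open>f * r * 32\<close>. Index sets of size \<open>2 ^ (2 * k + 19)\<close> then have room
        for \<open>Suc T\<close> elements per member of \<open>L\<close>. Starting at level 0 makes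
        the base point \<open>undefined\<close> irrelevant.\<close>
      have "\<exists>z. (\<forall>(X, J)\<in>L. graft 0 undefined z \<notin> X) \<and> (\<forall>t\<in>G. graft 0 undefined z \<notin> tset t)"
      proof (rule avoid_thin_and_covers[OF IH fin(1), of "2 ^ (k + 7)" f "2 ^ (k + 13)"])
        show "G \<subseteq> cls p (Suc k)" "(1::real) \<le> 2 ^ (k + 7)" "0 \<le> f" "finite L" "G \<subseteq> G"
          using fin by (auto simp: G_def f_def)
        show "wt (lvl t) c' \<le> f * tw t" if "t \<in> G" "real (card (tidx t)) \<le> 2 ^ (k + 7) * real c'" for t c'
        proof -
          have t: "t \<in> cls p (Suc k)" using that by (auto simp: G_def)
          have "wt (lvl t) c' \<le> (2 ^ (k + 7)) powr decay (lvl t) * tw t"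
            unfolding tw_def using that cls_memD(3)[OF t] by (intro wt_shrink) auto
          also have "\<dots> \<le> (2 ^ (k + 7)) powr decay (Suc k) * tw t"
            using cls_memD(5)[OF t] tw_nonneg by (intro mult_right_mono powr_mono decay_antimono) auto
          also have "(2 ^ (k + 7)) powr decay (Suc k) = (2 powr real (k + 7)) powr decay (Suc k)"
            by (subst powr_realpow) auto
          also have "\<dots> = 2 powr (real (k + 7) * decay (Suc k))" by (simp only: powr_powr)
          also have "real (k + 7) * decay (Suc k) = h"
          proof -
            have "Suc k + 6 = k + 7" by simp
            then have "decay (Suc k) = 1 / (real (k + 7) * 2 ^ Suc k)" by (simp only: decay_def)
            then show ?thesis unfolding h_def by (simp del: power_Suc of_nat_add add: power_one_over)
          qed
          finally show ?thesis by (simp add: f_def)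
        qed
        have "f * sum tw G \<le> f * sum tw F" using sG by (intro mult_left_mono) (auto simp: f_def)
        also have "\<dots> < f * 2 powr (5 - (1/2) ^ k)"
          using F(3) by (intro mult_strict_left_mono) (auto simp: f_def)
        also have "\<dots> = 2 powr (5 - h)"
          unfolding f_def powr_add[symmetric] h(1) by simp
        finally show "f * sum tw G < 2 powr (5 - h)" .
        have "sum tw G < 32" using sG W by simp
        then have "f * 2 ^ (k + 7) * sum tw G < f * 2 ^ (k + 7) * 32"
          by (intro mult_strict_left_mono) (auto simp: f_def)
        also have "\<dots> \<le> 2 * 2 ^ (k + 7) * 32" using f2 by (intro mult_right_mono) auto
        also have "\<dots> = real (2 ^ (k + 13))" by (simp add: power_add)
        finally show "f * 2 ^ (k + 7) * sum tw G < real (2 ^ (k + 13))" .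
        show "finite J \<and> card L * Suc (2 ^ (k + 13)) \<le> card (J \<inter> {0..}) \<and>
            (\<forall>m\<in>J. \<forall>n\<in>J. m < n \<longrightarrow> thin (cls p (Suc k)) m n X)" if "(X, J) \<in> L" for X J
        proof -
          obtain t where t0: "(X, J) = snd t" "t \<in> F2" using \<open>(X, J) \<in> L\<close> unfolding L_def by (rule imageE)
          from t0 have t: "t \<in> F2" "tset t = X" "tidx t = J" by (simp_all flip: t0(1))
          have tF: "t \<in> F" using t by (simp add: F2_def)
          then have tC: "t \<in> cls p k" using F by auto
          have "tw t < 32" using tw_le_sum[OF F(1) tF] W by simp
          from cls_card_ge[OF tC this] have "2 ^ (2 * k + 19) \<le> card J" using t F2(2) by simp
          moreover have "card L * Suc (2 ^ (k + 13)) \<le> 2 ^ (k + 5) * 2 ^ (k + 14)"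
          proof (rule mult_le_mono[OF cL])
            show "Suc (2 ^ (k + 13)) \<le> 2 ^ (k + 14)" by (simp add: Suc_le_eq)
          qed
          moreover have "2 ^ (k + 5) * 2 ^ (k + 14) = (2::nat) ^ (2 * k + 19)"
            unfolding power_add[symmetric] by (rule arg_cong[where f = "power 2"]) simp
          ultimately show ?thesis using F2(1)[OF t(1)] t by (simp add: thin_triples_def)
        qed
        show "real (2 * card L + 1) * real (card (tidx t)) \<le> 2 ^ (k + 7) * real (card (tidx t \<inter> {0..}))" for t
        proof -
          have "card L \<le> 2 ^ k * 32" using cL by (simp add: power_add)
          then have "2 * card L + 1 \<le> 2 ^ k * 128"
            using one_le_power[of "2::nat" k] by linarith
          then have "2 * card L + 1 \<le> 2 ^ (k + 7)" by (simp add: power_add)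
          then have "real (2 * card L + 1) \<le> 2 ^ (k + 7)" by (metis of_nat_le_iff of_nat_numeral of_nat_power)
          then show ?thesis by (simp add: mult_right_mono)
        qed
      qed
      then obtain z where z: "\<And>X J. (X, J) \<in> L \<Longrightarrow> z \<notin> X" "\<And>t. t \<in> G \<Longrightarrow> z \<notin> tset t" by auto
      have "z \<notin> tset t" if "t \<in> F" for t
      proof (cases "t \<in> G")
        case False
        then have "t \<in> F2" using that by (auto simp: G_def F2_def)
        then have "(tset t, tidx t) \<in> L" by (auto simp: L_def image_iff intro!: bexI[of _ t])
        then show ?thesis by (rule z)
      qed (use z in auto)
      then show ?thesis by blast
    qed
    then show ?thesis unfolding large_def by blast
  qed
qed

lemma large_cls_UNIV: "large (cls p k) 16 UNIV"
proof -
  have "2 powr (4::real) \<le> 2 powr (5 - (1/2) ^ k)" by (intro powr_mono) (auto simp: power_le_one)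
  then show ?thesis using large_mono[OF large_cls_UNIV_powr, of UNIV 16] by simp
qed

text \<open>Level \<open>n\<close> is a single index, so a large index set has a third of its
  elements below \<open>n\<close> or a third above. Triples of the first kind are avoided below
  level \<open>n\<close>, then the bits of level \<open>n\<close> are chosen to force
  \<open>Q\<close>, then the other triples are avoided above.\<close>

lemma large_cls_if_one_level_free:
  assumes Q: "\<And>x. \<exists>y. \<forall>z. graft (Suc n) (graft n x y) z \<in> Q"
  shows "large (cls p k) 1 Q"
  unfolding large_def
proof (intro allI impI notI)
  fix F assume F: "finite F" "F \<subseteq> cls p k" "sum tw F < 1" and cov: "Q \<subseteq> (\<Union>t\<in>F. tset t)"
  define G1 where "G1 = {t\<in>F. real (card (tidx t)) \<le> 3 * real (card (tidx t \<inter> {..<n}))}"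
  define G2 where "G2 = {t\<in>F. real (card (tidx t)) \<le> 3 * real (card (tidx t \<inter> {Suc n..}))}"
  have fin: "finite G1" "finite G2" using F by (auto simp: G1_def G2_def)
  have w: "3 * sum tw G1 < 16" "3 * sum tw G2 < 16"
    using sum_mono2[OF F(1), of G1 tw] sum_mono2[OF F(1), of G2 tw] F tw_nonneg
    by (auto simp: G1_def G2_def)
  define h1 where "h1 t = (lvl t, hull_at n (tset t), tidx t \<inter> {..<n})" for t :: triple
  have m1: "h1 t \<in> cls p k" "tw (h1 t) \<le> 3 * tw t" if "t \<in> G1" for t
  proof -
    have t: "t \<in> cls p k" "real (card (tidx t)) \<le> 3 * real (card (tidx t \<inter> {..<n}))"
      using that F by (auto simp: G1_def)
    have ne: "tidx t \<inter> {..<n} \<noteq> {}" using t(2) cls_memD(3)[OF t(1)] by (intro notI) simp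
    show "h1 t \<in> cls p k" unfolding h1_def using ne by (intro cls_hull_at[OF t(1)]) auto
    show "tw (h1 t) \<le> 3 * tw t" using cls_shrink[OF t(1) _ t(2)] by (simp add: h1_def tw_def)
  qed
  obtain z1 where z1: "\<And>t. t \<in> G1 \<Longrightarrow> z1 \<notin> tset (h1 t)"
    using large_avoid[OF large_cls_UNIV fin(1) m1 w(1)] by metis
  obtain y where y: "\<And>z. graft (Suc n) (graft n z1 y) z \<in> Q" using Q by blast
  define x where "x = graft n z1 y"
  define h2 where "h2 t = (lvl t, sec (Suc n) x (tset t), tidx t \<inter> {Suc n..})" for t :: triple
  have m2: "h2 t \<in> cls p k" "tw (h2 t) \<le> 3 * tw t" if "t \<in> G2" for t
  proof -
    have t: "t \<in> cls p k" "real (card (tidx t)) \<le> 3 * real (card (tidx t \<inter> {Suc n..}))"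
      using that F by (auto simp: G2_def)
    have ne: "tidx t \<inter> {Suc n..} \<noteq> {}" using t(2) cls_memD(3)[OF t(1)] by (intro notI) simp
    show "h2 t \<in> cls p k" unfolding h2_def using ne by (intro cls_sec[OF t(1)]) auto
    show "tw (h2 t) \<le> 3 * tw t" using cls_shrink[OF t(1) _ t(2)] by (simp add: h2_def tw_def)
  qed
  obtain z2 where z2: "\<And>t. t \<in> G2 \<Longrightarrow> z2 \<notin> tset (h2 t)"
    using large_avoid[OF large_cls_UNIV fin(2) m2 w(2)] by metis
  have "graft (Suc n) x z2 \<in> Q" using y by (simp add: x_def)
  then obtain t where t: "t \<in> F" "graft (Suc n) x z2 \<in> tset t" using cov by auto
  have "t \<notin> G1"
    using z1[of t] t by (auto simp: h1_def hull_at_def x_def graft_assoc)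
  moreover have "t \<notin> G2" using z2[of t] t by (auto simp: h2_def sec_def)
  ultimately have *: "3 * card (tidx t \<inter> {..<n}) < card (tidx t)" "3 * card (tidx t \<inter> {Suc n..}) < card (tidx t)"
    using t by (auto simp: G1_def G2_def)
  have tC: "t \<in> cls p k" using t F by auto
  define A where "A = tidx t \<inter> {..<n}"
  define B where "B = {n} \<inter> tidx t"
  define D where "D = tidx t \<inter> {Suc n..}"
  have "tidx t = (A \<union> B) \<union> D" by (auto simp: A_def B_def D_def)
  then have "card (tidx t) = card ((A \<union> B) \<union> D)" by (rule arg_cong)
  then have "card (tidx t) \<le> card A + card B + card D"
    using card_Un_le[of "A \<union> B" D] card_Un_le[of A B] by linarith
  moreover have "card B \<le> 1" using card_mono[of "{n}" B] by (simp add: B_def)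
  moreover have "2 ^ (2 * lvl t + 19) \<le> card (tidx t)"
    using cls_card_ge[OF tC] tw_le_sum[OF F(1) t(1)] F(3) by simp
  moreover have "(8::nat) \<le> 2 ^ (2 * lvl t + 19)"
    using power_increasing[of 3 "2 * lvl t + 19" "2::nat"] by simp
  ultimately show False using * unfolding A_def[symmetric] D_def[symmetric] by linarith
qed

definition block_cyl :: "nat \<Rightarrow> (nat \<Rightarrow> bool) \<Rightarrow> (nat \<Rightarrow> bool) set" where
  "block_cyl n \<tau> = {z. \<forall>j\<in>{n * n..<Suc n * Suc n}. z j = \<tau> j}"

lemma large_block_cyl: "large (cls p k) 1 (block_cyl n \<tau>)"
proof (rule large_cls_if_one_level_free)
  show "\<exists>y. \<forall>z. graft (Suc n) (graft n x y) z \<in> block_cyl n \<tau>" for x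
    by (rule exI[of _ \<tau>]) (auto simp: graft_def block_cyl_def)
qed

text \<open>Above every cylinder up to level \<open>m\<close>, following \<open>\<tau>\<close> on
  level \<open>m\<close> leads out of \<open>X\<close>; the hole thus contains a one-level cylinder,
  which is large.\<close>

lemma avoiding_blocks_in_cls:
  assumes "k < p" "finite I" "I \<noteq> {}" "card I \<le> full_card k" "\<And>n. n \<in> I \<Longrightarrow> X \<inter> block_cyl n \<tau> = {}"
  shows "(k, X, I) \<in> cls p k"
proof (rule cls_memI)
  fix m n assume mn: "m \<in> I" "n \<in> I" "m < n"
  have "block_cyl m \<tau> \<subseteq> - sec m x (hull_at n X)" for x
  proof
    fix z assume z: "z \<in> block_cyl m \<tau>"
    have "Suc m * Suc m \<le> n * n" using mn(3) by (intro mult_le_mono) auto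
    then have "graft n (graft m x z) y \<in> block_cyl m \<tau>" for y
      using z by (auto simp: graft_def block_cyl_def)
    then show "z \<in> - sec m x (hull_at n X)"
      using assms(5)[OF mn(1)] by (auto simp: sec_def hull_at_def)
  qed
  then show "thin (cls p (Suc k)) m n X"
    unfolding thin_def using large_mono[OF large_block_cyl] by blast
qed (use assms in auto)

section \<open>Making covers independent of the first levels and of the far levels\<close>

section \<open>Normalizing covers\<close>

text \<open>Triples with at least half of their indices below \<open>m\<close> are avoided by fixing
  the first levels as in \<open>z1\<close>. The slices of the others over \<open>z1\<close> still
  cover \<open>H\<close>, because \<open>H\<close> does not see these levels.\<close>

lemma cover_independent_of_initial:
  assumes F: "finite F" "F \<subseteq> cls p k" "H \<subseteq> (\<Union>t\<in>F. tset t)" "sum tw F < 8"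
    and H: "\<And>x. sec m x H = H"
  obtains G where "finite G" "G \<subseteq> cls p k" "H \<subseteq> (\<Union>t\<in>G. tset t)" "sum tw G \<le> 2 * sum tw F"
    "\<And>t x. t \<in> G \<Longrightarrow> sec m x (tset t) = tset t"
proof -
  define A where "A = {t\<in>F. real (card (tidx t)) \<le> 2 * real (card (tidx t \<inter> {..<m}))}"
  define h1 where "h1 t = (lvl t, hull_at m (tset t), tidx t \<inter> {..<m})" for t :: triple
  have fin: "finite A" using F by (simp add: A_def)
  have w: "2 * sum tw A < 16"
    using sum_mono2[OF F(1), of A tw] F tw_nonneg by (auto simp: A_def)
  have m1: "h1 t \<in> cls p k" "tw (h1 t) \<le> 2 * tw t" if "t \<in> A" for t
  proof -
    have t: "t \<in> cls p k" "real (card (tidx t)) \<le> 2 * real (card (tidx t \<inter> {..<m}))"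
      using that F by (auto simp: A_def)
    have ne: "tidx t \<inter> {..<m} \<noteq> {}" using t(2) cls_memD(3)[OF t(1)] by (intro notI) simp
    show "h1 t \<in> cls p k" unfolding h1_def using ne by (intro cls_hull_at[OF t(1)]) auto
    show "tw (h1 t) \<le> 2 * tw t" using cls_shrink[OF t(1) _ t(2)] by (simp add: h1_def tw_def)
  qed
  obtain z1 where z1: "\<And>t. t \<in> A \<Longrightarrow> z1 \<notin> tset (h1 t)"
    using large_avoid[OF large_cls_UNIV fin m1 w] by metis
  define h2 where "h2 t = (lvl t, sec m z1 (tset t), tidx t \<inter> {m..})" for t :: triple
  have m2: "h2 t \<in> cls p k" "tw (h2 t) \<le> 2 * tw t" if "t \<in> F - A" for t
  proof -
    have tF: "t \<in> cls p k" and tA: "\<not> real (card (tidx t)) \<le> 2 * real (card (tidx t \<inter> {..<m}))"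
      using that F by (auto simp: A_def)
    have "card (tidx t) = card (tidx t \<inter> {..<m}) + card (tidx t \<inter> {m..})"
      using card_Int_split[OF cls_memD(1)[OF tF], of 0 m] by (simp add: atLeast0LessThan)
    then have c: "real (card (tidx t)) \<le> 2 * real (card (tidx t \<inter> {m..}))" using tA by simp
    have ne: "tidx t \<inter> {m..} \<noteq> {}" using c cls_memD(3)[OF tF] by (intro notI) simp
    show "h2 t \<in> cls p k" unfolding h2_def using ne by (intro cls_sec[OF tF]) auto
    show "tw (h2 t) \<le> 2 * tw t" using cls_shrink[OF tF _ c] by (simp add: h2_def tw_def)
  qed
  show ?thesis
  proof (rule that[of "h2 ` (F - A)"])
    show "finite (h2 ` (F - A))" "h2 ` (F - A) \<subseteq> cls p k" using F m2 by auto
    show "H \<subseteq> (\<Union>t\<in>h2 ` (F - A). tset t)"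
    proof
      fix z assume "z \<in> H"
      then have "graft m z1 z \<in> H" using H[of z1] by (auto simp: sec_def)
      then obtain t where t: "t \<in> F" "graft m z1 z \<in> tset t" using F by auto
      then have "t \<notin> A" using z1[of t] by (auto simp: h1_def hull_at_def)
      then show "z \<in> (\<Union>t\<in>h2 ` (F - A). tset t)" using t by (auto simp: h2_def sec_def intro!: bexI[of _ t])
    qed
    have "sum tw (h2 ` (F - A)) \<le> sum (tw \<circ> h2) (F - A)" using F tw_nonneg by (intro sum_image_le) auto
    also have "\<dots> \<le> (\<Sum>t\<in>F - A. 2 * tw t)" using m2 by (intro sum_mono) auto
    also have "\<dots> \<le> (\<Sum>t\<in>F. 2 * tw t)" using F tw_nonneg by (intro sum_mono2) auto
    finally show "sum tw (h2 ` (F - A)) \<le> 2 * sum tw F" by (simp add: sum_distrib_left)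
    show "sec m x (tset t) = tset t" if "t \<in> h2 ` (F - A)" for t x
      using that by (auto simp: h2_def sec_def graft_graft_right)
  qed
qed

text \<open>A set whose index set lies mostly beyond level \<open>b\<close> does not help to cover a set that depends
  on the levels below \<open>b\<close> only. Cutting at the first level that sees half of the index set therefore
  gives covers that do not change with \<open>b\<close>.\<close>

definition half_level :: "triple \<Rightarrow> nat" where
  "half_level t = (LEAST n. card (tidx t) \<le> 2 * card (tidx t \<inter> {..<n}))"

definition cut_half :: "triple \<Rightarrow> triple" where
  "cut_half t = (lvl t, hull_at (half_level t) (tset t), tidx t \<inter> {..<half_level t})"

lemma card_half_level:
  assumes "finite (tidx t)"
  shows "card (tidx t) \<le> 2 * card (tidx t \<inter> {..<half_level t})"
  unfolding half_level_def
proof (rule LeastI)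
  have "tidx t \<inter> {..<Suc (Max (tidx t))} = tidx t" using assms by (auto simp: less_Suc_eq_le)
  then show "card (tidx t) \<le> 2 * card (tidx t \<inter> {..<Suc (Max (tidx t))})" by simp
qed

lemma cut_half_in_cls:
  assumes t: "t \<in> cls p k"
  shows "cut_half t \<in> cls p k" "tw (cut_half t) \<le> 2 * tw t"
proof -
  have c: "real (card (tidx t)) \<le> 2 * real (card (tidx t \<inter> {..<half_level t}))"
    using card_half_level[OF cls_memD(1)[OF t]] by linarith
  have ne: "tidx t \<inter> {..<half_level t} \<noteq> {}" using c cls_memD(3)[OF t] by (intro notI) simp
  show "cut_half t \<in> cls p k" unfolding cut_half_def using ne by (intro cls_hull_at[OF t]) auto
  show "tw (cut_half t) \<le> 2 * tw t" using cls_shrink[OF t _ c] by (simp add: cut_half_def tw_def)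
qed

lemma cover_by_cut_half:
  assumes F: "finite F" "F \<subseteq> cls p k" "H \<subseteq> (\<Union>t\<in>F. tset t)" "sum tw F < 8" and H: "lev_dep b H"
  shows "H \<subseteq> (\<Union>t\<in>{t\<in>F. half_level t \<le> b}. tset (cut_half t))"
proof
  fix z assume z: "z \<in> H"
  define B where "B = {t\<in>F. b < half_level t}"
  have fin: "finite B" using F by (simp add: B_def)
  have w: "2 * sum tw B < 16"
    using sum_mono2[OF F(1), of B tw] F tw_nonneg by (auto simp: B_def)
  define h where "h t = (lvl t, sec b z (tset t), tidx t \<inter> {b..})" for t :: triple
  have m: "h t \<in> cls p k" "tw (h t) \<le> 2 * tw t" if "t \<in> B" for t
  proof -
    have tF: "t \<in> cls p k" and tB: "b < half_level t" using that F by (auto simp: B_def)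
    have "\<not> card (tidx t) \<le> 2 * card (tidx t \<inter> {..<b})"
      using not_less_Least[OF tB[unfolded half_level_def]] .
    moreover have "card (tidx t) = card (tidx t \<inter> {..<b}) + card (tidx t \<inter> {b..})"
      using card_Int_split[OF cls_memD(1)[OF tF], of 0 b] by (simp add: atLeast0LessThan)
    ultimately have c: "real (card (tidx t)) \<le> 2 * real (card (tidx t \<inter> {b..}))" by simp
    have ne: "tidx t \<inter> {b..} \<noteq> {}" using c cls_memD(3)[OF tF] by (intro notI) simp
    show "h t \<in> cls p k" unfolding h_def using ne by (intro cls_sec[OF tF]) auto
    show "tw (h t) \<le> 2 * tw t" using cls_shrink[OF tF _ c] by (simp add: h_def tw_def)
  qed
  \<comment> \<open>Triples cut beyond \<open>b\<close> have at least half of their indices from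
    \<open>b\<close> on, so some continuation of \<open>z\<close> past level \<open>b\<close> avoids
    them all, and it stays in \<open>H\<close>.\<close>
  obtain y where y: "\<And>t. t \<in> B \<Longrightarrow> y \<notin> tset (h t)"
    using large_avoid[OF large_cls_UNIV fin m w] by metis
  have "graft b z y \<in> H" using z H by (auto simp: lev_dep_def)
  then obtain t where t: "t \<in> F" "graft b z y \<in> tset t" using F by auto
  then have "t \<notin> B" using y[of t] by (auto simp: h_def sec_def)
  then have le: "half_level t \<le> b" using t by (auto simp: B_def)
  then have "graft (half_level t) z (graft b z y) = graft b z y"
    by (metis graft_assoc graft_same)
  then have "z \<in> tset (cut_half t)" using t(2) by (auto simp: cut_half_def hull_at_def intro!: exI[of _ "graft b z y"])
  then show "z \<in> (\<Union>t\<in>{t\<in>F. half_level t \<le> b}. tset (cut_half t))" using t le by blast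
qed

section \<open>From the truncated classes to a limit class\<close>

section \<open>The limit along an ultrafilter\<close>

text \<open>Zorn's lemma gives a minimal proper filter below \<open>sequentially\<close>, and
  minimality makes it decide every predicate. Finer filters are smaller, so the order is reversed
  and a chain is bounded by its \<open>Inf\<close>.\<close>

lemma ex_ultrafilter:
  "\<exists>U :: nat filter. U \<noteq> bot \<and> U \<le> sequentially \<and> (\<forall>P. eventually P U \<or> eventually (\<lambda>x. \<not> P x) U)"
proof -
  define A where "A = {F :: nat filter. F \<noteq> bot \<and> F \<le> sequentially}"
  have "\<exists>m\<in>A. \<forall>a\<in>A. a \<le> m \<longrightarrow> a = m"
  proof (rule predicate_Zorn)
    show "partial_order_on A (relation_of (\<lambda>F G. G \<le> F) A)"
      by (rule partial_order_on_relation_ofI) auto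
    fix C assume C: "C \<in> Chains (relation_of (\<lambda>F G. G \<le> F) A)"
    have CA: "C \<subseteq> A" using C by (auto simp: Chains_def relation_of_def)
    show "\<exists>u\<in>A. \<forall>a\<in>C. u \<le> a"
    proof (cases "C = {}")
      case True
      then show ?thesis by (auto simp: A_def intro!: exI[of _ sequentially])
    next
      case False
      have "eventually P (Inf C) \<longleftrightarrow> (\<exists>b\<in>C. eventually P b)" for P
      proof (rule eventually_Inf_base[OF False])
        fix F G assume FG: "F \<in> C" "G \<in> C"
        then have "G \<le> F \<or> F \<le> G" using C by (auto simp: Chains_def relation_of_def)
        then show "\<exists>x\<in>C. x \<le> inf F G"
        proof
          assume "G \<le> F"
          then show ?thesis using FG by (intro bexI[of _ G]) simp_all
        next
          assume "F \<le> G"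
          then show ?thesis using FG by (intro bexI[of _ F]) simp_all
        qed
      qed
      note ev = this
      have "Inf C \<noteq> bot"
      proof
        assume "Inf C = bot"
        then have "eventually (\<lambda>_. False) (Inf C)" by simp
        then obtain b where "b \<in> C" "eventually (\<lambda>_. False) b" unfolding ev by blast
        then show False using CA by (auto simp: A_def)
      qed
      moreover have "Inf C \<le> sequentially" using False CA by (auto simp: A_def intro: Inf_lower2)
      ultimately have "Inf C \<in> A" by (simp add: A_def)
      then show ?thesis by (auto intro: Inf_lower)
    qed
  qed
  then obtain U where U: "U \<in> A" "\<And>F. F \<in> A \<Longrightarrow> F \<le> U \<Longrightarrow> F = U" by auto
  have "eventually P U \<or> eventually (\<lambda>x. \<not> P x) U" for P
  proof (cases "inf U (principal {x. P x}) = bot")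
    case True
    then have "eventually (\<lambda>x. False) (inf U (principal {x. P x}))" by simp
    then show ?thesis by (simp add: eventually_inf_principal)
  next
    case False
    then have "inf U (principal {x. P x}) = U" using U by (intro U(2)) (auto simp: A_def intro: le_infI1)
    moreover have "eventually P (inf U (principal {x. P x}))" by (simp add: eventually_inf_principal)
    ultimately show ?thesis by simp
  qed
  then show ?thesis using U by (auto simp: A_def)
qed

definition ultra :: "nat filter" where
  "ultra = (SOME U. U \<noteq> bot \<and> U \<le> sequentially \<and> (\<forall>P. eventually P U \<or> eventually (\<lambda>x. \<not> P x) U))"

lemma ultra:
  shows ultra_ne_bot: "ultra \<noteq> bot"
    and ultra_le: "ultra \<le> sequentially"
    and ultra_cases: "eventually P ultra \<or> eventually (\<lambda>x. \<not> P x) ultra"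
  using someI_ex[OF ex_ultrafilter] unfolding ultra_def by blast+

lemma ultra_ge: "eventually (\<lambda>p. n \<le> p) ultra"
  using filter_leD[OF ultra_le eventually_ge_at_top] .

text \<open>Finite data that vary with \<open>p\<close> get an exact limit: otherwise each of the
  finitely many values would be excluded along the ultrafilter, hence all at once.\<close>

lemma ultra_finite_limit:
  assumes "finite S" "eventually (\<lambda>p. f p \<in> S) ultra"
  obtains s where "s \<in> S" "eventually (\<lambda>p. f p = s) ultra"
proof -
  have "\<exists>s\<in>S. eventually (\<lambda>p. f p = s) ultra"
  proof (rule ccontr)
    assume "\<not> ?thesis"
    then have "\<forall>s\<in>S. eventually (\<lambda>p. f p \<noteq> s) ultra" using ultra_cases by blast
    then have "eventually (\<lambda>p. \<forall>s\<in>S. f p \<noteq> s) ultra" using assms(1) by (simp add: eventually_ball_finite)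
    with assms(2) have "eventually (\<lambda>p. False) ultra" by eventually_elim auto
    then show False using ultra_ne_bot by simp
  qed
  then show ?thesis using that by auto
qed

text \<open>The classes \<open>cls p k\<close> need not be monotone in \<open>p\<close>, since more
  covering sets of high rank leave fewer thin sets below; hence the limit along an
  ultrafilter.\<close>

definition cls_lim :: "nat \<Rightarrow> triple set" where
  "cls_lim k = {t. eventually (\<lambda>p. t \<in> cls p k) ultra}"

lemma cls_lim_antimono: "k \<le> l \<Longrightarrow> cls_lim l \<subseteq> cls_lim k"
  unfolding cls_lim_def using cls_antimono by (blast intro: eventually_mono)

lemma cls_lim_eventually:
  assumes "finite F" "F \<subseteq> cls_lim k"
  shows "eventually (\<lambda>p. F \<subseteq> cls p k) ultra"
proof -
  have "eventually (\<lambda>p. \<forall>t\<in>F. t \<in> cls p k) ultra"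
    using assms by (intro eventually_ball_finite) (auto simp: cls_lim_def)
  then show ?thesis unfolding subset_eq .
qed

definition coverable :: "nat \<Rightarrow> real \<Rightarrow> (nat \<Rightarrow> bool) set \<Rightarrow> bool" where
  "coverable k \<epsilon> A \<longleftrightarrow> (\<exists>F. finite F \<and> F \<subseteq> cls_lim k \<and> sum tw F \<le> \<epsilon> \<and> A \<subseteq> (\<Union>t\<in>F. tset t))"

lemma coverable_mono: "coverable k \<epsilon> A \<Longrightarrow> B \<subseteq> A \<Longrightarrow> \<epsilon> \<le> \<delta> \<Longrightarrow> l \<le> k \<Longrightarrow> coverable l \<delta> B"
  unfolding coverable_def using cls_lim_antimono[of l k] by (meson order.trans)

lemma coverable_empty: "0 \<le> \<epsilon> \<Longrightarrow> coverable k \<epsilon> {}"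
  unfolding coverable_def by (intro exI[of _ "{}"]) auto

lemma coverable_Un:
  assumes "coverable k \<epsilon> A" "coverable k \<delta> B"
  shows "coverable k (\<epsilon> + \<delta>) (A \<union> B)"
proof -
  obtain F where F: "finite F" "F \<subseteq> cls_lim k" "sum tw F \<le> \<epsilon>" "A \<subseteq> (\<Union>t\<in>F. tset t)"
    using assms(1) unfolding coverable_def by blast
  obtain G where G: "finite G" "G \<subseteq> cls_lim k" "sum tw G \<le> \<delta>" "B \<subseteq> (\<Union>t\<in>G. tset t)"
    using assms(2) unfolding coverable_def by blast
  have "sum tw (F \<union> G) = sum tw F + sum tw (G - F)"
    using F G by (subst sum.union_disjoint[symmetric]) auto
  also have "sum tw (G - F) \<le> sum tw G" using G tw_nonneg by (intro sum_mono2) auto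
  finally show ?thesis
    unfolding coverable_def using F G by (intro exI[of _ "F \<union> G"]) auto
qed

lemma coverable_UN:
  assumes "finite J" "\<And>j. j \<in> J \<Longrightarrow> coverable k (\<epsilon> j) (A j)"
  shows "coverable k (\<Sum>j\<in>J. \<epsilon> j) (\<Union>j\<in>J. A j)"
  using assms
proof (induction J rule: finite_induct)
  case empty
  show ?case by (simp add: coverable_empty)
next
  case (insert j J)
  have "coverable k (\<epsilon> j + sum \<epsilon> J) (A j \<union> (\<Union>j\<in>J. A j))"
    using insert.prems by (intro coverable_Un insert.IH) auto
  then show ?case using insert.hyps by simp
qed

lemma coverable_imp_cls_cover:
  assumes "coverable k \<epsilon> A" "eventually P ultra"
  obtains p F where "P p" "finite F" "F \<subseteq> cls p k" "sum tw F \<le> \<epsilon>" "A \<subseteq> (\<Union>t\<in>F. tset t)"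
proof -
  obtain F where F: "finite F" "F \<subseteq> cls_lim k" "sum tw F \<le> \<epsilon>" "A \<subseteq> (\<Union>t\<in>F. tset t)"
    using assms(1) unfolding coverable_def by blast
  have "eventually (\<lambda>p. P p \<and> F \<subseteq> cls p k) ultra"
    using assms(2) cls_lim_eventually[OF F(1,2)] by eventually_elim auto
  then obtain p where "P p" "F \<subseteq> cls p k" using eventually_happens'[OF ultra_ne_bot] by blast
  then show ?thesis using that F by blast
qed

definition cyl_reps :: "nat \<Rightarrow> (nat \<Rightarrow> bool) set" where
  "cyl_reps m = {x. \<forall>j\<ge>m * m. \<not> x j}"

lemma finite_cyl_reps: "finite (cyl_reps m)"
proof (rule inj_on_finite)
  show "inj_on Collect (cyl_reps m)" by (auto simp: inj_on_def)
  show "Collect ` cyl_reps m \<subseteq> Pow {..<m * m}" by (auto simp: cyl_reps_def) (meson not_le)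
qed simp

lemma graft_in_cyl_reps: "graft m x (\<lambda>_. False) \<in> cyl_reps m"
  by (auto simp: cyl_reps_def graft_def)

lemma finite_lev_dep: "finite {A. lev_dep n A}"
proof (rule inj_on_finite)
  show "inj_on (\<lambda>A. A \<inter> cyl_reps n) {A. lev_dep n A}"
  proof (rule inj_onI, rule set_eqI)
    fix A B x assume AB: "A \<in> {A. lev_dep n A}" "B \<in> {A. lev_dep n A}" "A \<inter> cyl_reps n = B \<inter> cyl_reps n"
    have "graft n x (\<lambda>_. False) \<in> A \<longleftrightarrow> graft n x (\<lambda>_. False) \<in> B"
      using AB(3) graft_in_cyl_reps[of n x] by blast
    then show "x \<in> A \<longleftrightarrow> x \<in> B" using AB by (simp add: lev_dep_def)
  qed
  show "(\<lambda>A. A \<inter> cyl_reps n) ` {A. lev_dep n A} \<subseteq> Pow (cyl_reps n)" by auto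
qed (simp add: finite_cyl_reps)

text \<open>For \<open>n < m\<close> the lemma \<open>hull_at_sec\<close> does not apply, but then
  \<open>X\<close> ignores the first \<open>n\<close> levels and its saturation is empty or
  everything.\<close>

lemma sec_hull_at_invariant:
  assumes "\<And>y. sec m y X = X"
  shows "sec m y (hull_at n X) = hull_at n X"
proof (cases "m \<le> n")
  case True
  then show ?thesis using assms by (simp flip: hull_at_sec)
next
  case False
  have inv: "graft m u z \<in> X \<longleftrightarrow> z \<in> X" for u z using assms[of u] by (auto simp: sec_def)
  have "graft n u z \<in> X \<longleftrightarrow> z \<in> X" for u z
    using inv[of undefined "graft n u z"] inv[of undefined z] False by (simp add: graft_graft_right)
  then show ?thesis by (auto simp: sec_def hull_at_def)
qed

lemma lev_dep_UN_atMost: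
  fixes E :: "nat \<Rightarrow> (nat \<Rightarrow> bool) set"
  assumes "\<forall>i. \<exists>n. lev_dep n (E i)"
  obtains b where "m \<le> b" "lev_dep b (\<Union>i\<le>r. E i)"
proof -
  obtain c where c: "\<And>i. lev_dep (c i) (E i)" using assms by metis
  have "lev_dep (max m (\<Sum>i\<le>r. c i)) (\<Union>i\<in>{..r}. E i)"
  proof (rule lev_dep_UN)
    fix i assume "i \<in> {..r}"
    then have "c i \<le> (\<Sum>i\<le>r. c i)" by (intro member_le_sum) auto
    then show "lev_dep (max m (\<Sum>i\<le>r. c i)) (E i)" using lev_dep_mono[OF c[of i]] by simp
  qed
  then show ?thesis using that[of "max m (\<Sum>i\<le>r. c i)"] by simp
qed

section \<open>The members of a disjoint sequence become cheap\<close>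

section \<open>Exhaustivity\<close>

lemma sum_UN_le:
  fixes f :: "'a \<Rightarrow> real"
  assumes "finite I" "\<And>i. i \<in> I \<Longrightarrow> finite (A i)" "\<And>x. 0 \<le> f x"
  shows "sum f (\<Union>i\<in>I. A i) \<le> (\<Sum>i\<in>I. sum f (A i))"
  using assms(1,2)
proof (induction I rule: finite_induct)
  case (insert i I)
  have "sum f (A i \<union> (\<Union>i\<in>I. A i)) + sum f (A i \<inter> (\<Union>i\<in>I. A i)) = sum f (A i) + sum f (\<Union>i\<in>I. A i)"
    using insert by (intro sum.union_inter) auto
  moreover have "0 \<le> sum f (A i \<inter> (\<Union>i\<in>I. A i))" using assms(3) by (intro sum_nonneg)
  moreover have "sum f (\<Union>i\<in>I. A i) \<le> (\<Sum>i\<in>I. sum f (A i))" using insert by auto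
  ultimately show ?case using insert.hyps by simp
qed simp

text \<open>Cheap covers of the single sets \<open>H r\<close> are merged into one countable family,
  graded by the level of the cut. The bound 4 comes from weight 1 by two doublings: one for
  independence of the levels below \<open>m\<close>, one for cutting at
  \<open>half_level\<close>.\<close>

lemma stable_covers:
  fixes H :: "nat \<Rightarrow> (nat \<Rightarrow> bool) set"
  assumes mono: "mono H" and inv: "\<And>r y. sec m y (H r) = H r"
    and lev: "\<And>r. lev_dep (b r) (H r)"
    and small: "\<And>r. eventually (\<lambda>p. \<not> large (cls p k) 1 (H r)) ultra"
  shows "\<exists>G. (\<forall>n. finite (G n)) \<and> (\<forall>n. G n \<subseteq> cls_lim k) \<and> (\<forall>r. H r \<subseteq> (\<Union>n\<le>b r. \<Union>t\<in>G n. tset t)) \<and>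
    (\<forall>n. \<forall>t\<in>G n. lev_dep n (tset t)) \<and> (\<forall>n. \<forall>t\<in>G n. \<forall>y. sec m y (tset t) = tset t) \<and>
    (\<forall>N. (\<Sum>n\<le>N. sum tw (G n)) \<le> 4)"
proof -
  define good where "good p F r \<longleftrightarrow> finite F \<and> F \<subseteq> cls p k \<and> sum tw F < 2 \<and>
    (\<forall>t\<in>F. \<forall>y. sec m y (tset t) = tset t) \<and> H r \<subseteq> (\<Union>t\<in>F. tset t)" for p F r
  have ev_good: "eventually (\<lambda>p. \<exists>F. good p F r) ultra" for r
    using small[of r]
  proof eventually_elim
    case (elim p)
    then obtain F where F: "finite F" "F \<subseteq> cls p k" "sum tw F < 1" "H r \<subseteq> (\<Union>t\<in>F. tset t)"
      unfolding large_def by blast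
    from F(3) have "sum tw F < 8" by simp
    from cover_independent_of_initial[OF F(1,2,4) this inv] obtain G where
      "finite G" "G \<subseteq> cls p k" "H r \<subseteq> (\<Union>t\<in>G. tset t)" "sum tw G \<le> 2 * sum tw F"
      "\<And>t x. t \<in> G \<Longrightarrow> sec m x (tset t) = tset t" by metis
    then have "good p G r" unfolding good_def using F(3) by auto
    then show ?case by blast
  qed
  have good_anti: "good p F s \<Longrightarrow> r \<le> s \<Longrightarrow> good p F r" for p F r s
    unfolding good_def using monoD[OF mono, of r s] by blast
  \<comment> \<open>Diagonal choice: \<open>F p\<close> covers \<open>H r\<close> for the largest
    \<open>r \<le> p\<close> that admits a good cover, so for each fixed \<open>r\<close> it covers
    \<open>H r\<close> eventually along \<open>ultra\<close>. The bound \<open>r \<le> p\<close>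
    makes the maximum exist.\<close>
  define R where "R p = {r. r \<le> p \<and> (\<exists>F. good p F r)}" for p
  have finR: "finite (R p)" for p unfolding R_def by (rule finite_subset[of _ "{..p}"]) auto
  define F where "F p = (SOME F. good p F (Max (R p)))" for p
  have F: "eventually (\<lambda>p. good p (F p) r) ultra" for r
    using ev_good[of r] ultra_ge[of r]
  proof eventually_elim
    case (elim p)
    then have "r \<in> R p" by (simp add: R_def)
    then have "Max (R p) \<in> R p" "r \<le> Max (R p)" using finR by (auto intro: Max_in)
    then have "good p (F p) (Max (R p))" unfolding F_def R_def by (auto intro: someI)
    then show ?case using good_anti \<open>r \<le> Max (R p)\<close> by blast
  qed
  define Gp where "Gp p n = cut_half ` {t\<in>F p. half_level t = n}" for p n
  \<comment> \<open>Sets of high rank have large index sets, so only finitely many triples can be cut at level \<open>n\<close>.\<close>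
  define S where "S n = {..<2 * n} \<times> {A. lev_dep n A} \<times> Pow {..<n}" for n
  have finS: "finite (S n)" for n unfolding S_def using finite_lev_dep by auto
  have "eventually (\<lambda>p. Gp p n \<in> Pow (S n)) ultra" for n
    using F[of 0]
  proof eventually_elim
    case (elim p)
    have "cut_half t \<in> S n" if t: "t \<in> F p" "half_level t = n" for t
    proof -
      have tC: "t \<in> cls p k" using t elim unfolding good_def by blast
      have "tw t < 32" using tw_le_sum[of "F p" t] t elim unfolding good_def by simp
      then have c: "2 ^ (2 * lvl t + 19) \<le> card (tidx t)" using cls_card_ge[OF tC] by simp
      have "lvl t < 2 ^ lvl t" by (rule less_exp)
      also have "\<dots> \<le> 2 ^ (2 * lvl t + 19)" by (intro power_increasing) auto
      also have "\<dots> \<le> 2 * card (tidx t \<inter> {..<n})"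
        using c card_half_level[OF cls_memD(1)[OF tC]] t(2) by simp
      also have "\<dots> \<le> 2 * n" using card_mono[of "{..<n}" "tidx t \<inter> {..<n}"] by simp
      finally show ?thesis using t(2) lev_dep_hull_at by (auto simp: S_def cut_half_def)
    qed
    then show ?case unfolding Gp_def by blast
  qed
  then have "\<exists>G. G \<in> Pow (S n) \<and> eventually (\<lambda>p. Gp p n = G) ultra" for n
    using ultra_finite_limit[of "Pow (S n)" "\<lambda>p. Gp p n"] finS by (metis finite_Pow_iff)
  then obtain G where G: "\<And>n. G n \<subseteq> S n" "\<And>n. eventually (\<lambda>p. Gp p n = G n) ultra"
    by (metis PowD)
  have GpI: "t \<in> cls p k \<and> sec m y (tset t) = tset t" if g: "good p (F p) r" and t: "t \<in> Gp p n" for p r n t y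
  proof -
    obtain u where u: "u \<in> F p" "t = cut_half u" using t unfolding Gp_def by blast
    then have "u \<in> cls p k" "\<And>y. sec m y (tset u) = tset u" using g unfolding good_def by blast+
    then show ?thesis
      using cut_half_in_cls(1)[of u p k] sec_hull_at_invariant[of m "tset u" y] u(2) by (simp add: cut_half_def)
  qed
  have ev_eq: "eventually (\<lambda>p. good p (F p) r \<and> (\<forall>n\<le>N. Gp p n = G n)) ultra" for r N
  proof (rule eventually_conj[OF F])
    have "eventually (\<lambda>p. \<forall>n\<in>{..N}. Gp p n = G n) ultra"
      using G(2) by (intro eventually_ball_finite) auto
    then show "eventually (\<lambda>p. \<forall>n\<le>N. Gp p n = G n) ultra" by (rule eventually_mono) simp
  qed
  have pick: "\<exists>p. good p (F p) r \<and> (\<forall>n\<le>N. Gp p n = G n)" for r N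
    using eventually_happens'[OF ultra_ne_bot ev_eq[of r N]] .
  show ?thesis
  proof (intro exI[of _ G] conjI allI ballI)
    show "finite (G n)" for n using G(1) finS finite_subset by blast
    show "G n \<subseteq> cls_lim k" for n
    proof
      fix t assume t: "t \<in> G n"
      have "eventually (\<lambda>p. t \<in> cls p k) ultra"
        using ev_eq[of 0 n] by eventually_elim (use t GpI in blast)
      then show "t \<in> cls_lim k" by (simp add: cls_lim_def)
    qed
    show "H r \<subseteq> (\<Union>n\<le>b r. \<Union>t\<in>G n. tset t)" for r
    proof -
      \<comment> \<open>Only triples cut at a level up to \<open>b r\<close> are needed to cover
        \<open>H r\<close>, so agreement of \<open>Gp p\<close> with \<open>G\<close> at finitely
        many levels suffices.\<close>
      obtain p where p: "good p (F p) r" "\<forall>n\<le>b r. Gp p n = G n" using pick by blast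
      have Fp: "finite (F p)" "F p \<subseteq> cls p k" "H r \<subseteq> (\<Union>t\<in>F p. tset t)" "sum tw (F p) < 8"
        using p(1) unfolding good_def by auto
      have "H r \<subseteq> (\<Union>t\<in>{t\<in>F p. half_level t \<le> b r}. tset (cut_half t))"
        by (rule cover_by_cut_half[OF Fp lev])
      also have "\<dots> \<subseteq> (\<Union>n\<le>b r. \<Union>t\<in>Gp p n. tset t)" unfolding Gp_def by blast
      also have "\<dots> = (\<Union>n\<le>b r. \<Union>t\<in>G n. tset t)" using p(2) by simp
      finally show ?thesis .
    qed
    show "lev_dep n (tset t)" if "t \<in> G n" for n t using that G(1)[of n] by (auto simp: S_def)
    show "sec m y (tset t) = tset t" if "t \<in> G n" for n t y
      using that pick[of 0 n] GpI by blast
    show "(\<Sum>n\<le>N. sum tw (G n)) \<le> 4" for N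
    proof -
      obtain p where p: "good p (F p) 0" "\<forall>n\<le>N. Gp p n = G n" using pick by blast
      have Fp: "finite (F p)" "F p \<subseteq> cls p k" "sum tw (F p) < 2" using p(1) unfolding good_def by auto
      have "sum tw (G n) \<le> (\<Sum>t\<in>{t\<in>F p. half_level t = n}. 2 * tw t)" if "n \<le> N" for n
      proof -
        have "sum tw (G n) = sum tw (cut_half ` {t\<in>F p. half_level t = n})" using p(2) that by (simp add: Gp_def)
        also have "\<dots> \<le> sum (tw \<circ> cut_half) {t\<in>F p. half_level t = n}"
          using Fp(1) tw_nonneg by (intro sum_image_le) auto
        also have "\<dots> \<le> (\<Sum>t\<in>{t\<in>F p. half_level t = n}. 2 * tw t)"
        proof (rule sum_mono)
          fix t assume "t \<in> {t\<in>F p. half_level t = n}"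
          then show "(tw \<circ> cut_half) t \<le> 2 * tw t" using cut_half_in_cls(2)[of t p k] Fp(2) by (simp add: subset_eq)
        qed
        finally show ?thesis .
      qed
      then have "(\<Sum>n\<le>N. sum tw (G n)) \<le> (\<Sum>n\<le>N. \<Sum>t\<in>{t\<in>F p. half_level t = n}. 2 * tw t)"
        by (intro sum_mono) simp
      also have "\<dots> = (\<Sum>n\<le>N. \<Sum>t\<in>{t\<in>{t\<in>F p. half_level t \<le> N}. half_level t = n}. 2 * tw t)"
        by (intro sum.cong refl arg_cong2[where f = sum]) auto
      also have "\<dots> = (\<Sum>t\<in>{t\<in>F p. half_level t \<le> N}. 2 * tw t)"
        using Fp(1) by (intro sum.group) auto
      also have "\<dots> \<le> (\<Sum>t\<in>F p. 2 * tw t)" using Fp(1) tw_nonneg by (intro sum_mono2) auto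
      also have "\<dots> = 2 * sum tw (F p)" by (simp add: sum_distrib_left)
      finally show ?thesis using Fp(3) by simp
    qed
  qed
qed

text \<open>Either some \<open>V r\<close> has a large slice, and then \<open>D = - V r\<close>
  contains all later members of the sequence; or all slices are cheap, and
  \<open>stable_covers\<close> gives a family of finite total weight, an initial part of which forms
  \<open>D\<close> while the tail covers what \<open>D\<close> misses.\<close>

lemma thin_in_cylinder:
  fixes E :: "nat \<Rightarrow> (nat \<Rightarrow> bool) set"
  assumes disj: "disjoint_family E" and lev: "\<forall>i. \<exists>n. lev_dep n (E i)" and \<epsilon>: "0 < \<epsilon>"
  shows "\<exists>D n i0. m < n \<and> eventually (\<lambda>p. large (cls p k) 1 (- sec m x (hull_at n D))) ultra \<and>
    (\<forall>i\<ge>i0. coverable k \<epsilon> ({z \<in> E i. graft m x z = z} - D))"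
proof -
  define V where "V r = (\<Union>i\<le>r. E i)" for r
  have "\<exists>b. m \<le> b \<and> lev_dep b (V r)" for r
    using lev_dep_UN_atMost[OF lev, of m r] unfolding V_def by blast
  then obtain b where b: "\<And>r. m \<le> b r" "\<And>r. lev_dep (b r) (V r)" by metis
  define H where "H r = sec m x (V r)" for r
  show ?thesis
  proof (cases "\<exists>r. eventually (\<lambda>p. large (cls p k) 1 (H r)) ultra")
    case True
    then obtain r where r: "eventually (\<lambda>p. large (cls p k) 1 (H r)) ultra" by blast
    \<comment> \<open>The successor secures the strict inequality \<open>m < n\<close>.\<close>
    have "lev_dep (Suc (b r)) (- V r)" using b(2)[of r] by (intro lev_dep_Compl) (auto intro: lev_dep_mono)
    then have "hull_at (Suc (b r)) (- V r) = - V r" by (rule lev_dep_hull_at_eq)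
    then have "- sec m x (hull_at (Suc (b r)) (- V r)) = H r" by (auto simp: H_def sec_def)
    moreover have "coverable k \<epsilon> ({z \<in> E i. graft m x z = z} - - V r)" if "i \<ge> Suc r" for i
    proof -
      have "E i \<inter> E j = {}" if "j \<le> r" for j
        using disj[unfolded disjoint_family_on_def, rule_format, of i j] that \<open>i \<ge> Suc r\<close> by simp
      then have "E i \<inter> V r = {}" unfolding V_def by blast
      then have "{z \<in> E i. graft m x z = z} - - V r = {}" by auto
      then show ?thesis using coverable_empty \<epsilon> by simp
    qed
    ultimately show ?thesis using r b(1)[of r]
      by (intro exI[of _ "- V r"] exI[of _ "Suc (b r)"] exI[of _ "Suc r"]) auto
  next
    case False
    then have small: "eventually (\<lambda>p. \<not> large (cls p k) 1 (H r)) ultra" for r using ultra_cases by blast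
    have mono: "mono H"
      unfolding H_def V_def by (intro monoI sec_mono) fastforce
    have inv: "sec m y (H r) = H r" for r y by (auto simp: H_def sec_def graft_graft_right)
    have levH: "lev_dep (b r) (H r)" for r unfolding H_def using b by (intro lev_dep_sec) auto
    obtain G where G': "\<forall>n. finite (G n)" "\<forall>n. G n \<subseteq> cls_lim k"
      "\<forall>r. H r \<subseteq> (\<Union>n\<le>b r. \<Union>t\<in>G n. tset t)" "\<forall>n. \<forall>t\<in>G n. lev_dep n (tset t)"
      "\<forall>n. \<forall>t\<in>G n. \<forall>y. sec m y (tset t) = tset t" "\<forall>N. (\<Sum>n\<le>N. sum tw (G n)) \<le> 4"
      using stable_covers[where H = H and m = m and b = b and k = k, OF mono inv levH small]
      by (elim exE conjE) (rule that)
    note G = G'[rule_format]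
    have G0: "0 \<le> sum tw (G n)" for n using tw_nonneg by (intro sum_nonneg)
    have "summable (\<lambda>n. sum tw (G n))"
      by (rule bounded_imp_summable[OF G0 G(6)])
    then obtain Q where Q: "\<And>q n. Q \<le> q \<Longrightarrow> norm (\<Sum>n\<in>{q..<n}. sum tw (G n)) < \<epsilon>"
      using \<epsilon> unfolding summable_Cauchy by blast
    define F0 where "F0 = (\<Union>n<Q. G n)"
    define D where "D = (\<Union>t\<in>F0. tset t)"
    define n0 where "n0 = max Q (Suc m)"
    have F0: "finite F0" "F0 \<subseteq> cls_lim k" using G by (auto simp: F0_def)
    have "sum tw F0 \<le> (\<Sum>n<Q. sum tw (G n))"
      unfolding F0_def using G tw_nonneg by (intro sum_UN_le) auto
    also have "\<dots> \<le> (\<Sum>n\<le>Q. sum tw (G n))" using G0 by (intro sum_mono2) auto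
    also have "\<dots> \<le> 4" by (rule G)
    finally have wF0: "sum tw F0 \<le> 4" .
    have "lev_dep n0 D"
      unfolding D_def
    proof (rule lev_dep_UN)
      fix t assume "t \<in> F0"
      then obtain n where "n < Q" "t \<in> G n" by (auto simp: F0_def)
      then show "lev_dep n0 (tset t)" using lev_dep_mono[OF G(4)] by (simp add: n0_def)
    qed
    then have hD: "hull_at n0 D = D" by (rule lev_dep_hull_at_eq)
    have sD: "sec m x D = D"
    proof -
      have "sec m x D = (\<Union>t\<in>F0. sec m x (tset t))" by (simp add: D_def sec_def Collect_ex_eq Collect_bex_eq)
      also have "\<dots> = D" unfolding D_def using G(5) by (auto simp: F0_def)
      finally show ?thesis .
    qed
    \<comment> \<open>A cover of \<open>- D\<close> of weight below 1, together with
      \<open>F0\<close> of weight at most 4, would cover the whole space with weight below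
      16.\<close>
    have "eventually (\<lambda>p. large (cls p k) 1 (- D)) ultra"
      using cls_lim_eventually[OF F0]
    proof eventually_elim
      case (elim p)
      show ?case
        unfolding large_def
      proof (intro allI impI notI)
        fix F assume F: "finite F" "F \<subseteq> cls p k" "sum tw F < 1" "- D \<subseteq> (\<Union>t\<in>F. tset t)"
        have "sum tw (F \<union> F0) = sum tw F + sum tw (F0 - F)"
          using F F0 by (subst sum.union_disjoint[symmetric]) auto
        moreover have "sum tw (F0 - F) \<le> sum tw F0" using F0 tw_nonneg by (intro sum_mono2) auto
        ultimately have "sum tw (F \<union> F0) < 16" using F(3) wF0 by simp
        moreover have "UNIV \<subseteq> (\<Union>t\<in>F \<union> F0. tset t)" using F(4) unfolding D_def by blast
        ultimately show False
          using large_cls_UNIV[of p k] F elim F0 unfolding large_def by (metis finite_Un Un_least)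
      qed
    qed
    then have "eventually (\<lambda>p. large (cls p k) 1 (- sec m x (hull_at n0 D))) ultra" using hD sD by simp
    moreover have "coverable k \<epsilon> ({z \<in> E i. graft m x z = z} - D)" for i
    proof -
      define F where "F = (\<Union>n\<in>{Q..<Suc (b i)}. G n)"
      have "sum tw F \<le> (\<Sum>n\<in>{Q..<Suc (b i)}. sum tw (G n))"
        unfolding F_def using G tw_nonneg by (intro sum_UN_le) auto
      also have "\<dots> \<le> \<epsilon>" using Q[OF order_refl, of "Suc (b i)"] by simp
      finally have wF: "sum tw F \<le> \<epsilon>" .
      have "{z \<in> E i. graft m x z = z} - D \<subseteq> (\<Union>t\<in>F. tset t)"
      proof
        fix z assume z: "z \<in> {z \<in> E i. graft m x z = z} - D"
        then have "z \<in> H i" by (auto simp: H_def V_def sec_def)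
        then obtain n t where nt: "n \<le> b i" "t \<in> G n" "z \<in> tset t" using G(3)[of i] by blast
        have "\<not> n < Q" using z nt by (auto simp: D_def F0_def)
        then have "t \<in> F" using nt unfolding F_def by (intro UN_I[of n]) auto
        then show "z \<in> (\<Union>t\<in>F. tset t)" using nt by blast
      qed
      then show ?thesis
        unfolding coverable_def using wF G by (intro exI[of _ F]) (auto simp: F_def)
    qed
    ultimately show ?thesis by (intro exI[of _ D] exI[of _ n0]) (auto simp: n0_def)
  qed
qed

text \<open>The sets found over the finitely many cylinders up to level \<open>m\<close> are glued
  together, each with the error \<open>\<epsilon> / card R\<close>.\<close>

lemma thin_step:
  fixes E :: "nat \<Rightarrow> (nat \<Rightarrow> bool) set"
  assumes disj: "disjoint_family E" and lev: "\<forall>i. \<exists>n. lev_dep n (E i)" and \<epsilon>: "0 < \<epsilon>"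
  shows "\<exists>D n i0. m < n \<and> eventually (\<lambda>p. thin (cls p k) m n D) ultra \<and>
    (\<forall>i\<ge>i0. coverable k \<epsilon> (E i - D))"
proof -
  define R where "R = cyl_reps m"
  have R: "finite R" "R \<noteq> {}" using finite_cyl_reps graft_in_cyl_reps by (auto simp: R_def)
  define \<delta> where "\<delta> = \<epsilon> / real (card R)"
  have \<delta>: "0 < \<delta>" using R \<epsilon> by (simp add: \<delta>_def card_gt_0_iff)
  obtain D n i0 where D: "\<And>x. m < n x"
    "\<And>x. eventually (\<lambda>p. large (cls p k) 1 (- sec m x (hull_at (n x) (D x)))) ultra"
    "\<And>x i. i \<ge> i0 x \<Longrightarrow> coverable k \<delta> ({z \<in> E i. graft m x z = z} - D x)"
  proof -
    have "\<forall>x. \<exists>D n i0. m < n \<and>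
        eventually (\<lambda>p. large (cls p k) 1 (- sec m x (hull_at n D))) ultra \<and>
        (\<forall>i\<ge>i0. coverable k \<delta> ({z \<in> E i. graft m x z = z} - D))"
      using thin_in_cylinder[OF disj lev \<delta>] by blast
    then show ?thesis unfolding choice_iff using that by blast
  qed
  define D' where "D' = (\<Union>x\<in>R. {z \<in> D x. graft m x z = z})"
  define n' where "n' = Max (n ` R)"
  define i' where "i' = Max (i0 ` R)"
  have n': "n x \<le> n'" "i0 x \<le> i'" if "x \<in> R" for x using that R by (auto simp: n'_def i'_def)
  have rep_eq: "x = graft m u (\<lambda>_. False)" if "x \<in> R" "graft m x u = u" for x u
  proof -
    have "graft m x (\<lambda>_. False) = x"
      using that(1) by (auto simp: R_def cyl_reps_def graft_def fun_eq_iff not_less)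
    then show ?thesis using graft_graft_left[of m m x u "\<lambda>_. False"] that(2) by simp
  qed
  have "eventually (\<lambda>p. \<forall>x\<in>R. large (cls p k) 1 (- sec m x (hull_at (n x) (D x)))) ultra"
    using D(2) R by (intro eventually_ball_finite) auto
  then have "eventually (\<lambda>p. thin (cls p k) m n' D') ultra"
  proof eventually_elim
    case (elim p)
    show ?case
      unfolding thin_def
    proof
      fix x
      define y where "y = graft m x (\<lambda>_. False)"
      have y: "y \<in> R" unfolding y_def R_def by (rule graft_in_cyl_reps)
      have gy: "graft m y z = graft m x z" for z by (simp add: y_def graft_graft_left)
      have "m \<le> n'" using D(1)[of y] n'(1)[OF y] by simp
      have "sec m x (hull_at n' D') \<subseteq> sec m y (hull_at (n y) (D y))"
      proof
        fix z assume "z \<in> sec m x (hull_at n' D')"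
        then obtain w where w: "graft n' (graft m x z) w \<in> D'" by (auto simp: sec_def hull_at_def)
        then obtain y' where y': "y' \<in> R" "graft n' (graft m x z) w \<in> D y'"
          "graft m y' (graft n' (graft m x z) w) = graft n' (graft m x z) w" by (auto simp: D'_def)
        \<comment> \<open>The cylinder of \<open>x\<close> meets only the piece of \<open>D'\<close>
          that belongs to its own representative \<open>y\<close>.\<close>
        have "y' = graft m (graft n' (graft m x z) w) (\<lambda>_. False)" using rep_eq[OF y'(1,3)] .
        also have "\<dots> = y" using \<open>m \<le> n'\<close> by (simp add: y_def graft_graft_left)
        finally have "graft m x z \<in> hull_at n' (D y)" using y'(2) by (auto simp: hull_at_def)
        then have "graft m y z \<in> hull_at (n y) (D y)" using hull_at_antimono[OF n'(1)[OF y]] gy by auto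
        then show "z \<in> sec m y (hull_at (n y) (D y))" by (simp add: sec_def)
      qed
      then have "- sec m y (hull_at (n y) (D y)) \<subseteq> - sec m x (hull_at n' D')" by auto
      then show "large (cls p k) 1 (- sec m x (hull_at n' D'))"
        using large_mono bspec[OF elim y] by blast
    qed
  qed
  moreover have "m < n'" using R D(1) n'(1) by (meson all_not_in_conv less_le_trans)
  moreover have "coverable k \<epsilon> (E i - D')" if "i \<ge> i'" for i
  proof -
    have "coverable k (\<Sum>x\<in>R. \<delta>) (\<Union>x\<in>R. {z \<in> E i. graft m x z = z} - D x)"
    proof (rule coverable_UN[OF R(1)])
      fix x assume "x \<in> R"
      then show "coverable k \<delta> ({z \<in> E i. graft m x z = z} - D x)" using D(3)[of x i] n'(2)[of x] that by simp
    qed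
    moreover have "E i - D' \<subseteq> (\<Union>x\<in>R. {z \<in> E i. graft m x z = z} - D x)"
    proof
      fix z assume z: "z \<in> E i - D'"
      define x where "x = graft m z (\<lambda>_. False)"
      have "x \<in> R" unfolding x_def R_def by (rule graft_in_cyl_reps)
      moreover have "graft m x z = z" by (simp add: x_def graft_graft_left)
      ultimately show "z \<in> (\<Union>x\<in>R. {z \<in> E i. graft m x z = z} - D x)" using z by (auto simp: D'_def)
    qed
    moreover have "(\<Sum>x\<in>R. \<delta>) = \<epsilon>" using R by (simp add: \<delta>_def)
    ultimately show ?thesis using coverable_mono by auto
  qed
  ultimately show ?thesis by blast
qed

text \<open>Iterating \<open>thin_step\<close> gives \<open>full_card k\<close> levels. The part of
  \<open>E i\<close> inside all sets \<open>D m\<close> is thin between any two of them and costs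
  \<open>(1/2) ^ k\<close>; the parts outside some \<open>D m\<close> cost at most
  \<open>\<epsilon>\<close> altogether.\<close>

lemma eventually_coverable:
  fixes E :: "nat \<Rightarrow> (nat \<Rightarrow> bool) set"
  assumes disj: "disjoint_family E" and lev: "\<forall>i. \<exists>n. lev_dep n (E i)" and \<epsilon>: "0 < \<epsilon>"
  shows "\<exists>i0. \<forall>i\<ge>i0. coverable k ((1/2) ^ k + \<epsilon>) (E i)"
proof -
  define \<delta> where "\<delta> = \<epsilon> / real (full_card k)"
  have \<delta>: "0 < \<delta>" using \<epsilon> full_card_pos by (simp add: \<delta>_def)
  obtain D nx i0 where D: "\<And>m. m < nx m" "\<And>m. eventually (\<lambda>p. thin (cls p (Suc k)) m (nx m) (D m)) ultra"
    "\<And>m i. i \<ge> i0 m \<Longrightarrow> coverable (Suc k) \<delta> (E i - D m)"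
  proof -
    have "\<forall>m. \<exists>D n i0. m < n \<and> eventually (\<lambda>p. thin (cls p (Suc k)) m n D) ultra \<and>
        (\<forall>i\<ge>i0. coverable (Suc k) \<delta> (E i - D))"
      using thin_step[OF disj lev \<delta>] by blast
    then show ?thesis unfolding choice_iff using that by blast
  qed
  define lev where "lev s = (nx ^^ s) 0" for s
  have sm: "strict_mono lev" unfolding lev_def strict_mono_Suc_iff using D(1) by simp
  define I where "I = lev ` {..<full_card k}"
  have cI: "card I = full_card k" unfolding I_def by (subst card_image) (use sm in \<open>auto intro: strict_mono_imp_inj_on\<close>)
  have I: "finite I" "I \<noteq> {}" using cI full_card_pos[of k] by (auto simp: I_def lessThan_empty_iff)
  have nxt: "nx a \<le> b" if ab: "a \<in> I" "b \<in> I" "a < b" for a b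
  proof -
    obtain s s' where s: "a = lev s" "b = lev s'" using ab(1,2) by (auto simp: I_def)
    then have "s < s'" using ab(3) sm by (simp add: strict_mono_less)
    then have "lev (Suc s) \<le> lev s'" using sm by (simp add: strict_mono_less_eq Suc_le_eq)
    then show ?thesis using s by (simp add: lev_def)
  qed
  have ev: "eventually (\<lambda>p. Suc k \<le> p \<and> (\<forall>m\<in>I. thin (cls p (Suc k)) m (nx m) (D m))) ultra"
    using D(2) I by (intro eventually_conj ultra_ge eventually_ball_finite) auto
  have "coverable k ((1/2) ^ k + \<epsilon>) (E i)" if i: "i \<ge> Max (i0 ` I)" for i
  proof -
    define X where "X = E i \<inter> (\<Inter>m\<in>I. D m)"
    have "eventually (\<lambda>p. (k, X, I) \<in> cls p k) ultra"
      using ev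
    proof eventually_elim
      case (elim p)
      show ?case
      proof (rule cls_memI)
        fix m n assume mn: "m \<in> I" "n \<in> I" "m < n"
        show "thin (cls p (Suc k)) m n X"
        proof (rule thin_mono[OF _ _ nxt[OF mn]])
          show "thin (cls p (Suc k)) m (nx m) (D m)" using elim mn(1) by blast
          show "X \<subseteq> D m" using mn(1) by (auto simp: X_def)
        qed
      qed (use elim I cI in auto)
    qed
    then have "(k, X, I) \<in> cls_lim k" by (simp add: cls_lim_def)
    then have 1: "coverable k ((1/2) ^ k) X"
      unfolding coverable_def using cI by (intro exI[of _ "{(k, X, I)}"]) (simp add: tw_def wt_full)
    have 2: "coverable k (\<Sum>m\<in>I. \<delta>) (\<Union>m\<in>I. E i - D m)"
    proof (rule coverable_UN[OF I(1)])
      fix m assume "m \<in> I"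
      then have "i0 m \<le> i" using i I Max_ge[of "i0 ` I" "i0 m"] by auto
      from coverable_mono[OF D(3)[OF this] order_refl order_refl, of k]
      show "coverable k \<delta> (E i - D m)" by simp
    qed
    have "(\<Sum>m\<in>I. \<delta>) = \<epsilon>" using cI full_card_pos[of k] by (simp add: \<delta>_def)
    moreover have "E i \<subseteq> X \<union> (\<Union>m\<in>I. E i - D m)" by (auto simp: X_def)
    ultimately show ?thesis using coverable_mono[OF coverable_Un[OF 1 2]] by simp
  qed
  then show ?thesis by blast
qed

section \<open>Clopen sets are the sets that depend on finitely many levels\<close>

section \<open>Clopen sets and the submeasure\<close>

lemma open_cylinder: "open {z :: nat \<Rightarrow> bool. \<forall>i<n. z i = x i}"
proof -
  have "open {z :: nat \<Rightarrow> bool. z i = x i}" for i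
  proof -
    have "open ((\<lambda>z :: nat \<Rightarrow> bool. z i) -` {x i})"
      by (intro open_vimage open_discrete continuous_on_product_coordinates)
    then show ?thesis by (simp add: vimage_def)
  qed
  then have "open (\<Inter>i\<in>{..<n}. {z :: nat \<Rightarrow> bool. z i = x i})" by (intro open_INT) auto
  moreover have "(\<Inter>i\<in>{..<n}. {z :: nat \<Rightarrow> bool. z i = x i}) = {z. \<forall>i<n. z i = x i}" by auto
  ultimately show ?thesis by simp
qed

lemma lev_dep_open:
  assumes "lev_dep n A"
  shows "open A"
proof -
  have "z \<in> A" if "x \<in> A" "\<forall>i<n * n. z i = x i" for x z
  proof -
    have "graft n x z = z" using that(2) by (auto simp: graft_def)
    then show ?thesis using assms that(1) unfolding lev_dep_def by metis
  qed
  then have "A = (\<Union>x\<in>A. {z. \<forall>i<n * n. z i = x i})" by auto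
  moreover have "open (\<Union>x\<in>A. {z. \<forall>i<n * n. z i = x i})" using open_cylinder by (intro open_UN) auto
  ultimately show ?thesis by simp
qed

lemma lev_dep_imp_clopen: "lev_dep n A \<Longrightarrow> A \<in> cantor_clopen"
  using lev_dep_open[of n A] lev_dep_open[of n "- A"] lev_dep_Compl
  by (auto simp: cantor_clopen_def closed_def)

lemma compact_cantor: "compact (UNIV :: (nat \<Rightarrow> bool) set)"
proof -
  have "compact_space (product_topology (\<lambda>_. euclidean) UNIV :: (nat \<Rightarrow> bool) topology)"
    by (simp add: compact_space_product_topology) (simp add: compact_space_def finite_imp_compact)
  then show ?thesis by (simp add: euclidean_product_topology compact_space_def)
qed

lemma open_contains_cylinder:
  fixes A :: "(nat \<Rightarrow> bool) set"
  assumes "open A" "x \<in> A"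
  obtains n where "{z. \<forall>i<n. z i = x i} \<subseteq> A"
proof -
  have "openin (product_topology (\<lambda>_. euclidean) UNIV) A"
    using assms(1) by (simp add: euclidean_product_topology)
  from product_topology_open_contains_basis[OF this assms(2)] obtain X where
    X: "x \<in> (\<Pi>\<^sub>E i\<in>UNIV. X i)" "finite {i. X i \<noteq> (UNIV :: bool set)}" "(\<Pi>\<^sub>E i\<in>UNIV. X i) \<subseteq> A" by auto
  obtain n where n: "\<And>i. X i \<noteq> UNIV \<Longrightarrow> i < n"
    using X(2) finite_nat_set_iff_bounded by auto
  have sub: "{z. \<forall>i<n. z i = x i} \<subseteq> (\<Pi>\<^sub>E i\<in>UNIV. X i)"
  proof
    fix z assume z: "z \<in> {z. \<forall>i<n. z i = x i}"
    have "z i \<in> X i" for i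
    proof (cases "X i = UNIV")
      case False
      then have "z i = x i" using n z by simp
      then show ?thesis using X(1) by (simp add: PiE_iff)
    qed simp
    then show "z \<in> (\<Pi>\<^sub>E i\<in>UNIV. X i)" by (simp add: PiE_iff)
  qed
  show ?thesis by (rule that[OF order.trans[OF sub X(3)]])
qed

text \<open>By compactness, finitely many cylinders, each inside \<open>A\<close> or inside its
  complement, cover the space; the sum of their lengths bounds the bits that matter.\<close>

lemma clopen_imp_lev_dep:
  assumes "A \<in> cantor_clopen"
  shows "\<exists>n. lev_dep n A"
proof -
  have op: "open A" "open (- A)" using assms by (auto simp: cantor_clopen_def)
  have "\<exists>n. {z. \<forall>i<n. z i = x i} \<subseteq> A \<or> {z. \<forall>i<n. z i = x i} \<subseteq> - A" for x
  proof (cases "x \<in> A")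
    case True
    then obtain n where "{z. \<forall>i<n. z i = x i} \<subseteq> A" by (rule open_contains_cylinder[OF op(1)])
    then show ?thesis by blast
  next
    case False
    then have "x \<in> - A" by simp
    then obtain n where "{z. \<forall>i<n. z i = x i} \<subseteq> - A" by (rule open_contains_cylinder[OF op(2)])
    then show ?thesis by blast
  qed
  then have "\<forall>x. \<exists>n. {z. \<forall>i<n. z i = x i} \<subseteq> A \<or> {z. \<forall>i<n. z i = x i} \<subseteq> - A" by blast
  then obtain c where c: "\<And>x. {z. \<forall>i<c x. z i = x i} \<subseteq> A \<or> {z. \<forall>i<c x. z i = x i} \<subseteq> - A"
    unfolding choice_iff by blast
  have "UNIV \<subseteq> (\<Union>x\<in>UNIV. {z. \<forall>i<c x. z i = x i})" by auto
  then obtain C where C: "finite C" "UNIV \<subseteq> (\<Union>x\<in>C. {z. \<forall>i<c x. z i = x i})"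
    by (rule compactE_image[OF compact_cantor open_cylinder]) blast
  define n where "n = (\<Sum>x\<in>C. c x)"
  have "z' \<in> A \<longleftrightarrow> z \<in> A" if "\<forall>i<n. z' i = z i" for z z'
  proof -
    obtain x where x: "x \<in> C" "\<forall>i<c x. z i = x i" using C(2) by blast
    have "c x \<le> n" unfolding n_def using C(1) x(1) by (intro member_le_sum) auto
    then have "\<forall>i<c x. z' i = x i" using that x(2) by simp
    then show ?thesis using c[of x] x(2) by blast
  qed
  \<comment> \<open>Agreement up to level \<open>n\<close> concerns \<open>n * n\<close> bits, hence
    at least the first \<open>n\<close>.\<close>
  moreover have "\<forall>i<n. graft n x y i = x i" for x y
    by (simp add: graft_def less_le_trans[OF _ Nat.le_square])
  ultimately have "lev_dep n A" unfolding lev_dep_def by blast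
  then show ?thesis ..
qed

section \<open>The submeasure: the infimum of the weights of covers from the limit class\<close>

definition lim_submeasure :: "(nat \<Rightarrow> bool) set \<Rightarrow> real" where
  "lim_submeasure A = Inf {w. \<exists>F. finite F \<and> F \<subseteq> cls_lim 0 \<and> A \<subseteq> (\<Union>t\<in>F. tset t) \<and> w = sum tw F}"

lemma coverable_UNIV: "\<exists>w. coverable 0 w UNIV"
proof -
  \<comment> \<open>A one-element index set has no pair to test, so even \<open>UNIV\<close> belongs
    to the class. Every set thus has a cover, and the infimum is over a nonempty set.\<close>
  have "eventually (\<lambda>p. (0, UNIV, {0}) \<in> cls p 0) ultra"
    using ultra_ge[of 1] by eventually_elim (auto intro!: cls_memI simp: full_card_def)
  then have "(0, UNIV, {0}) \<in> cls_lim 0" by (simp add: cls_lim_def)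
  then show ?thesis
    unfolding coverable_def by (intro exI[of _ "tw (0, UNIV, {0})"] exI[of _ "{(0, UNIV, {0})}"]) auto
qed

lemma bdd_below_covers: "bdd_below {w. \<exists>F. finite F \<and> F \<subseteq> C \<and> A \<subseteq> (\<Union>t\<in>F. tset t) \<and> w = sum tw F}"
  by (rule bdd_belowI[of _ 0]) (auto intro!: sum_nonneg tw_nonneg)

lemma lim_submeasure_le: "coverable k w A \<Longrightarrow> lim_submeasure A \<le> w"
proof -
  assume "coverable k w A"
  then have "coverable 0 w A" using coverable_mono by blast
  then obtain F where F: "finite F" "F \<subseteq> cls_lim 0" "sum tw F \<le> w" "A \<subseteq> (\<Union>t\<in>F. tset t)"
    unfolding coverable_def by blast
  then have "lim_submeasure A \<le> sum tw F" unfolding lim_submeasure_def by (intro cInf_lower bdd_below_covers) auto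
  then show ?thesis using F(3) by simp
qed

lemma lim_submeasure_approx:
  assumes "0 < \<epsilon>"
  shows "coverable 0 (lim_submeasure A + \<epsilon>) A"
proof -
  define S where "S = {w. \<exists>F. finite F \<and> F \<subseteq> cls_lim 0 \<and> A \<subseteq> (\<Union>t\<in>F. tset t) \<and> w = sum tw F}"
  have "S \<noteq> {}"
    using coverable_UNIV unfolding coverable_def S_def by blast
  moreover have "Inf S < lim_submeasure A + \<epsilon>" using assms by (simp add: S_def lim_submeasure_def)
  ultimately obtain w where "w \<in> S" "w < lim_submeasure A + \<epsilon>" by (meson cInf_lessD)
  then show ?thesis unfolding S_def coverable_def by fastforce
qed

lemma lim_submeasure_nonneg: "0 \<le> lim_submeasure A"
proof (rule field_le_epsilon)
  fix \<epsilon> :: real assume "0 < \<epsilon>"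
  from lim_submeasure_approx[OF this, of A] show "0 \<le> lim_submeasure A + \<epsilon>"
    unfolding coverable_def using tw_nonneg by (meson order.trans sum_nonneg)
qed

lemma submeasure_lim_submeasure: "submeasure B lim_submeasure"
proof -
  have "lim_submeasure {} = 0" using lim_submeasure_le[OF coverable_empty[of 0 0]] lim_submeasure_nonneg[of "{}"] by simp
  moreover have "lim_submeasure A \<le> lim_submeasure A'" if "A \<subseteq> A'" for A A'
  proof (rule field_le_epsilon)
    fix \<epsilon> :: real assume "0 < \<epsilon>"
    from coverable_mono[OF lim_submeasure_approx[OF this, of A'] that] show "lim_submeasure A \<le> lim_submeasure A' + \<epsilon>"
      using lim_submeasure_le by blast
  qed
  moreover have "lim_submeasure (A \<union> A') \<le> lim_submeasure A + lim_submeasure A'" for A A'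
  proof (rule field_le_epsilon)
    fix \<epsilon> :: real assume "0 < \<epsilon>"
    then have "0 < \<epsilon> / 2" by simp
    from lim_submeasure_le[OF coverable_Un[OF lim_submeasure_approx[OF this, of A] lim_submeasure_approx[OF this, of A']]]
    show "lim_submeasure (A \<union> A') \<le> lim_submeasure A + lim_submeasure A' + \<epsilon>" by simp
  qed
  ultimately show ?thesis using lim_submeasure_nonneg by (simp add: submeasure_def increasing_def)
qed

lemma exhaustive_lim_submeasure: "exhaustive_on cantor_clopen lim_submeasure"
  unfolding exhaustive_on_def
proof (intro allI impI)
  fix E :: "nat \<Rightarrow> (nat \<Rightarrow> bool) set"
  assume E: "range E \<subseteq> cantor_clopen" "disjoint_family E"
  have lev: "\<forall>i. \<exists>n. lev_dep n (E i)" using E(1) clopen_imp_lev_dep by blast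
  show "(\<lambda>n. lim_submeasure (E n)) \<longlonglongrightarrow> 0"
  proof (rule LIMSEQ_I)
    fix r :: real assume "0 < r"
    then have "0 < r / 2" by simp
    then obtain k where k: "(1/2) ^ k < r / 2" using real_arch_pow_inv[of "r / 2" "1/2"] by auto
    obtain i0 where i0: "\<And>i. i \<ge> i0 \<Longrightarrow> coverable k ((1/2) ^ k + r / 2) (E i)"
      using eventually_coverable[OF E(2) lev \<open>0 < r / 2\<close>] by blast
    have "norm (lim_submeasure (E i) - 0) < r" if "i \<ge> i0" for i
      using lim_submeasure_le[OF i0[OF that]] k lim_submeasure_nonneg[of "E i"] by simp
    then show "\<exists>no. \<forall>n\<ge>no. norm (lim_submeasure (E n) - 0) < r" by blast
  qed
qed

text \<open>A cover of weight below 1 from the limit class would lie in some \<open>cls p 0\<close>,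
  against \<open>large_block_cyl\<close>.\<close>

lemma lim_submeasure_block_cyl_ge: "1 \<le> lim_submeasure (block_cyl n \<tau>)"
proof (rule ccontr)
  assume less: "\<not> ?thesis"
  then have "0 < (1 - lim_submeasure (block_cyl n \<tau>)) / 2" by simp
  from lim_submeasure_approx[OF this, of "block_cyl n \<tau>"]
  obtain p F where "finite F" "F \<subseteq> cls p 0"
    "sum tw F \<le> lim_submeasure (block_cyl n \<tau>) + (1 - lim_submeasure (block_cyl n \<tau>)) / 2" "block_cyl n \<tau> \<subseteq> (\<Union>t\<in>F. tset t)"
    using coverable_imp_cls_cover[of 0 _ _ "\<lambda>_. True"] by (metis eventually_True)
  moreover have "lim_submeasure (block_cyl n \<tau>) + (1 - lim_submeasure (block_cyl n \<tau>)) / 2 < 1"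
    using less by (simp add: field_simps)
  ultimately show False using large_block_cyl[of p 0 n \<tau>] unfolding large_def by (meson order.strict_trans1)
qed

lemma block_cyl_clopen: "block_cyl n \<tau> \<in> cantor_clopen"
proof (rule lev_dep_imp_clopen)
  show "lev_dep (Suc n) (block_cyl n \<tau>)" by (auto simp: lev_dep_def block_cyl_def graft_def)
qed

section \<open>Disjoint one-level cylinders against finitely additive measures\<close>

section \<open>Comparison with measures\<close>

text \<open>The pattern on level \<open>n\<close> has a single one, at position \<open>i\<close>.
  The positions from 1 to \<open>n\<close> give \<open>n\<close> disjoint sets of submeasure at
  least 1.\<close>

definition spike :: "nat \<Rightarrow> nat \<Rightarrow> (nat \<Rightarrow> bool) set" where
  "spike n i = block_cyl n (\<lambda>j. j = n * n + i)"

lemma spike_disjoint: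
  assumes "i \<le> n" "i \<noteq> i'"
  shows "spike n i \<inter> spike n i' = {}"
proof -
  have "n * n + i \<in> {n * n..<Suc n * Suc n}" using assms(1) by auto
  then have "z (n * n + i)" if "z \<in> spike n i" for z
    using that by (simp add: spike_def block_cyl_def)
  moreover have "\<not> z (n * n + i)" if "z \<in> spike n i'" for z
    using that \<open>n * n + i \<in> _\<close> assms(2) by (simp add: spike_def block_cyl_def)
  ultimately show ?thesis by blast
qed

lemma spike_clopen: "spike n i \<in> cantor_clopen"
  unfolding spike_def by (rule block_cyl_clopen)

lemma fin_add_measure_UN:
  assumes \<mu>: "fin_add_measure cantor_clopen \<mu>" and J: "finite J" "\<And>j. j \<in> J \<Longrightarrow> A j \<in> cantor_clopen"
    and disj: "disjoint_family_on A J"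
  shows "(\<Union>j\<in>J. A j) \<in> cantor_clopen \<and> \<mu> (\<Union>j\<in>J. A j) = (\<Sum>j\<in>J. \<mu> (A j))"
  using J disj
proof (induction J rule: finite_induct)
  case empty
  then show ?case using \<mu> by (simp add: fin_add_measure_def submeasure_def cantor_clopen_def)
next
  case (insert j J)
  have IH: "(\<Union>j\<in>J. A j) \<in> cantor_clopen" "\<mu> (\<Union>j\<in>J. A j) = (\<Sum>j\<in>J. \<mu> (A j))"
    using insert by (auto simp: disjoint_family_on_def)
  have "A j \<inter> (\<Union>j\<in>J. A j) = {}" using insert by (auto simp: disjoint_family_on_def)
  then have "\<mu> (A j \<union> (\<Union>j\<in>J. A j)) = \<mu> (A j) + \<mu> (\<Union>j\<in>J. A j)"
    using \<mu> IH insert.prems(1) by (simp add: fin_add_measure_def additive_def)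
  moreover have "A j \<union> (\<Union>j\<in>J. A j) \<in> cantor_clopen"
    using IH insert.prems(1)[of j] by (auto simp: cantor_clopen_def)
  ultimately show ?case using insert.hyps IH by simp
qed

lemma fin_add_measure_mono:
  assumes "fin_add_measure cantor_clopen \<mu>" "A \<in> cantor_clopen" "B \<in> cantor_clopen" "A \<subseteq> B"
  shows "0 \<le> \<mu> A" "\<mu> A \<le> \<mu> B"
  using assms by (auto simp: fin_add_measure_def submeasure_def increasing_def)

lemma UNIV_clopen: "UNIV \<in> cantor_clopen" by (simp add: cantor_clopen_def)

lemma sum_spikes_le:
  assumes \<mu>: "fin_add_measure cantor_clopen \<mu>"
  shows "(\<Sum>i\<in>{1..n}. \<mu> (spike n i)) \<le> \<mu> UNIV"
proof -
  have "disjoint_family_on (spike n) {1..n}"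
    using spike_disjoint by (auto simp: disjoint_family_on_def)
  from fin_add_measure_UN[OF \<mu> _ _ this] spike_clopen
  have "(\<Union>i\<in>{1..n}. spike n i) \<in> cantor_clopen"
    "\<mu> (\<Union>i\<in>{1..n}. spike n i) = (\<Sum>i\<in>{1..n}. \<mu> (spike n i))" by auto
  then show ?thesis using fin_add_measure_mono(2)[OF \<mu> _ UNIV_clopen] by (metis subset_UNIV)
qed

lemma not_uniformly_exhaustive_lim_submeasure: "\<not> uniformly_exhaustive_on cantor_clopen lim_submeasure"
proof
  assume "uniformly_exhaustive_on cantor_clopen lim_submeasure"
  then have "\<exists>n\<ge>1. \<forall>E :: nat \<Rightarrow> (nat \<Rightarrow> bool) set. E ` {1..n} \<subseteq> cantor_clopen \<longrightarrow> disjoint_family_on E {1..n} \<longrightarrow>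
      (INF i\<in>{1..n}. lim_submeasure (E i)) \<le> 1/2"
    unfolding uniformly_exhaustive_on_def by (elim allE[of _ "1/2"]) (erule mp, simp)
  then obtain n :: nat where n: "n \<ge> 1" "\<And>E. E ` {1..n} \<subseteq> cantor_clopen \<Longrightarrow> disjoint_family_on E {1..n} \<Longrightarrow>
      (INF i\<in>{1..n}. lim_submeasure (E i)) \<le> 1/2" by blast
  have "(INF i\<in>{1..n}. lim_submeasure (spike n i)) \<le> 1/2"
    using spike_disjoint spike_clopen by (intro n(2)) (auto simp: disjoint_family_on_def)
  moreover have "1 \<le> (INF i\<in>{1..n}. lim_submeasure (spike n i))"
    using n(1) lim_submeasure_block_cyl_ge by (intro cINF_greatest) (auto simp: spike_def)
  ultimately show False by simp
qed

text \<open>Absolute continuity would bound the measure of every spike below by some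
  \<open>\<alpha> > 0\<close>, and enough disjoint spikes at one level would exceed
  \<open>\<mu> UNIV\<close>.\<close>

lemma not_abs_cont_lim_submeasure:
  assumes \<mu>: "fin_add_measure cantor_clopen \<mu>"
  shows "\<not> abs_cont_on cantor_clopen lim_submeasure \<mu>"
proof
  assume "abs_cont_on cantor_clopen lim_submeasure \<mu>"
  then obtain \<alpha> where \<alpha>: "\<alpha> > 0" "\<And>A. A \<in> cantor_clopen \<Longrightarrow> \<mu> A \<le> \<alpha> \<Longrightarrow> lim_submeasure A \<le> 1/2"
    unfolding abs_cont_on_def by (meson half_gt_zero zero_less_one)
  have "\<alpha> \<le> \<mu> (spike n i)" for n i
  proof (rule ccontr)
    assume "\<not> ?thesis"
    then have "lim_submeasure (spike n i) \<le> 1/2" by (intro \<alpha>(2) spike_clopen) simp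
    moreover have "1 \<le> lim_submeasure (spike n i)" unfolding spike_def by (rule lim_submeasure_block_cyl_ge)
    ultimately show False by simp
  qed
  then have "(\<Sum>i\<in>{1..n}. \<alpha>) \<le> (\<Sum>i\<in>{1..n}. \<mu> (spike n i))" for n by (intro sum_mono)
  then have "real n * \<alpha> \<le> \<mu> UNIV" for n using order.trans[OF _ sum_spikes_le[OF \<mu>, of n]] by simp
  then show False using \<alpha>(1) reals_Archimedean3 by (metis linorder_not_less)
qed

text \<open>The complement of \<open>N = full_card k\<close> spikes at levels \<open>n \<ge> 2 * N\<close>, each of measure at most
  \<open>M / n\<close>, is cheap but has at least half of the total measure.\<close>

lemma not_abs_cont_wrt_lim_submeasure:
  assumes \<mu>: "fin_add_measure cantor_clopen \<mu>" "nonzero_on cantor_clopen \<mu>"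
  shows "\<not> abs_cont_on cantor_clopen \<mu> lim_submeasure"
proof
  assume ac: "abs_cont_on cantor_clopen \<mu> lim_submeasure"
  define M where "M = \<mu> UNIV"
  obtain A where "A \<in> cantor_clopen" "\<mu> A \<noteq> 0" using \<mu>(2) by (auto simp: nonzero_on_def)
  then have "0 < M" using fin_add_measure_mono[OF \<mu>(1) _ UNIV_clopen, of A] unfolding M_def by force
  then have "0 < M / 4" by simp
  then obtain \<alpha> where \<alpha>: "\<alpha> > 0" "\<And>A. A \<in> cantor_clopen \<Longrightarrow> lim_submeasure A \<le> \<alpha> \<Longrightarrow> \<mu> A \<le> M / 4"
    using ac unfolding abs_cont_on_def by metis
  obtain k where k: "(1/2) ^ k < \<alpha>" using real_arch_pow_inv[of \<alpha> "1/2"] \<alpha>(1) by auto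
  define N where "N = full_card k"
  have N: "0 < N" unfolding N_def by (rule full_card_pos)
  define I where "I = {2 * N..<3 * N}"
  have I: "finite I" "I \<noteq> {}" "card I = N" using N by (auto simp: I_def)
  \<comment> \<open>Averaging: the \<open>n\<close> disjoint spikes at level \<open>n\<close> share
    the mass \<open>M\<close>.\<close>
  have "\<exists>i\<in>{1..n}. real n * \<mu> (spike n i) \<le> M" if "n \<in> I" for n
  proof (rule ccontr)
    assume a: "\<not> ?thesis"
    have n: "0 < n" using that N by (auto simp: I_def)
    have "(\<Sum>i\<in>{1..n}. M) < (\<Sum>i\<in>{1..n}. real n * \<mu> (spike n i))"
      using a n by (intro sum_strict_mono) (auto simp: not_le dest: bspec)
    also have "\<dots> = real n * (\<Sum>i\<in>{1..n}. \<mu> (spike n i))" by (simp add: sum_distrib_left)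
    also have "\<dots> \<le> real n * M" using sum_spikes_le[OF \<mu>(1), of n] by (intro mult_left_mono) (auto simp: M_def)
    finally show False by simp
  qed
  then obtain c where c: "\<And>n. n \<in> I \<Longrightarrow> c n \<in> {1..n}" "\<And>n. n \<in> I \<Longrightarrow> real n * \<mu> (spike n (c n)) \<le> M" by metis
  define U where "U = (\<Union>n\<in>I. spike n (c n))"
  have U: "U \<in> cantor_clopen" "- U \<in> cantor_clopen"
    using I(1) spike_clopen by (auto simp: U_def cantor_clopen_def)
  have "\<mu> U \<le> (\<Sum>n\<in>I. \<mu> (spike n (c n)))"
  proof -
    have "(\<Union>n\<in>J. spike n (c n)) \<in> cantor_clopen \<and> \<mu> (\<Union>n\<in>J. spike n (c n)) \<le> (\<Sum>n\<in>J. \<mu> (spike n (c n)))"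
      if "finite J" for J
      using that
    proof (induction J rule: finite_induct)
      case empty
      then show ?case using \<mu> by (simp add: fin_add_measure_def submeasure_def cantor_clopen_def)
    next
      case (insert n J)
      then have "\<mu> (spike n (c n) \<union> (\<Union>n\<in>J. spike n (c n))) \<le> \<mu> (spike n (c n)) + \<mu> (\<Union>n\<in>J. spike n (c n))"
        using \<mu>(1) spike_clopen by (simp add: fin_add_measure_def submeasure_def)
      then show ?case using insert spike_clopen[of n "c n"] by (auto simp: cantor_clopen_def)
    qed
    then show ?thesis using I(1) by (simp add: U_def)
  qed
  also have "\<dots> \<le> (\<Sum>n\<in>I. M / (2 * real N))"
  proof (rule sum_mono)
    fix n assume n: "n \<in> I"
    then have nN: "2 * real N \<le> real n" by (auto simp: I_def)
    have "2 * real N * \<mu> (spike n (c n)) \<le> real n * \<mu> (spike n (c n))"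
      using nN fin_add_measure_mono(1)[OF \<mu>(1) spike_clopen UNIV_clopen] by (intro mult_right_mono) auto
    then show "\<mu> (spike n (c n)) \<le> M / (2 * real N)" using c(2)[OF n] N by (simp add: field_simps)
  qed
  also have "\<dots> = M / 2" using I(3) N by simp
  finally have "\<mu> U \<le> M / 2" .
  moreover have "\<mu> (- U) \<le> M / 4"
  proof (rule \<alpha>(2)[OF U(2)])
    \<comment> \<open>Distinct levels use disjoint blocks of bits, so one pattern describes all
      chosen spikes, as \<open>avoiding_blocks_in_cls\<close> requires.\<close>
    define \<tau> where "\<tau> j = (\<exists>n\<in>I. j = n * n + c n)" for j
    have "spike n (c n) = block_cyl n \<tau>" if n: "n \<in> I" for n
    proof -
      have "\<tau> j \<longleftrightarrow> j = n * n + c n" if j: "j \<in> {n * n..<Suc n * Suc n}" for j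
      proof
        assume "\<tau> j"
        then obtain n' where n': "n' \<in> I" "j = n' * n' + c n'" by (auto simp: \<tau>_def)
        have "j \<in> {n' * n'..<Suc n' * Suc n'}" using c(1)[OF n'(1)] n'(2) by auto
        then have "\<not> Suc n \<le> n'" "\<not> Suc n' \<le> n"
          using j mult_le_mono[of "Suc n" n' "Suc n" n'] mult_le_mono[of "Suc n'" n "Suc n'" n] by auto
        then have "n' = n" by simp
        then show "j = n * n + c n" using n'(2) by simp
      qed (use n in \<open>auto simp: \<tau>_def\<close>)
      then show ?thesis by (auto simp: spike_def block_cyl_def)
    qed
    then have av: "- U \<inter> block_cyl n \<tau> = {}" if "n \<in> I" for n using that by (auto simp: U_def)
    have "eventually (\<lambda>p. (k, - U, I) \<in> cls p k) ultra"
      using ultra_ge[of "Suc k"]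
      by eventually_elim (use I av in \<open>auto intro!: avoiding_blocks_in_cls simp: N_def\<close>)
    then have "(k, - U, I) \<in> cls_lim k" by (simp add: cls_lim_def)
    then have "coverable k ((1/2) ^ k) (- U)"
      unfolding coverable_def using I(3)
      by (intro exI[of _ "{(k, - U, I)}"]) (simp add: tw_def wt_full N_def)
    from lim_submeasure_le[OF this] show "lim_submeasure (- U) \<le> \<alpha>" using k by simp
  qed
  moreover have "M \<le> \<mu> U + \<mu> (- U)"
    using \<mu>(1) U unfolding M_def fin_add_measure_def submeasure_def by (metis Compl_partition)
  ultimately show False using \<open>0 < M\<close> by simp
qed

theorem theorem1p1:
  shows "\<exists>\<nu> :: (nat \<Rightarrow> bool) set \<Rightarrow> real.
           submeasure cantor_clopen \<nu> \<and>
           nonzero_on cantor_clopen \<nu> \<and>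
           exhaustive_on cantor_clopen \<nu> \<and>
           \<not> uniformly_exhaustive_on cantor_clopen \<nu> \<and>
           \<not> (\<exists>\<mu>. fin_add_measure cantor_clopen \<mu> \<and> abs_cont_on cantor_clopen \<nu> \<mu>) \<and>
           \<not> (\<exists>\<mu>. fin_add_measure cantor_clopen \<mu> \<and> nonzero_on cantor_clopen \<mu> \<and>
                  abs_cont_on cantor_clopen \<mu> \<nu>)"
proof (intro exI[of _ lim_submeasure] conjI)
  show "nonzero_on cantor_clopen lim_submeasure"
    unfolding nonzero_on_def using spike_clopen[of 0 0] lim_submeasure_block_cyl_ge[of 0 "\<lambda>j. j = 0 * 0 + 0"]
    by (intro bexI[of _ "spike 0 0"]) (auto simp: spike_def)
qed (use submeasure_lim_submeasure exhaustive_lim_submeasure not_uniformly_exhaustive_lim_submeasure not_abs_cont_lim_submeasure not_abs_cont_wrt_lim_submeasure in blast)+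

end
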